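(* Let $\Phi=(A;\{E_i\}_{i=0}^d;A^*;\{E^*_i\}_{i=0}^d)$ be a Leonard system in $\mathcal{A}$ with parameter array $(\{\theta_i\}_{i=0}^d;\{\theta^*_i\}_{i=0}^d;\{\varphi_i\}_{i=1}^d;\{\phi_i\}_{i=1}^d)$, and let $\xi_0\in E_0V$, $\xi_d\in E_dV$, $\xi^*_0\in E^*_0V$, $\xi^*_d\in E^*_dV$ be nonzero vectors. Then (i) and (ii) hold. (i) Let $\{X_i\}_{i=0}^d$ denote one of the sequences $\{E_i\}_{i=0}^d$, $\{E_{d-i}\}_{i=0}^d$, $\{\tau_i(A)\}_{i=0}^d$, $\{\tau_{d-i}(A)\}_{i=0}^d$, $\{\eta_i(A)\}_{i=0}^d$, $\{\eta_{d-i}(A)\}_{i=0}^d$. Then for $0\le i\le d$, \begin{align*} \frac{\langle\xi^*_0,\xi^*_0\rangle}{\langle\xi_d,\xi^*_0\rangle}\sum_{r=0}^d\frac{X_rE^*_0\eta_r(A)}{\phi_1\phi_2\cdots\phi_r}\cdot\tau^*_i(A^* )\xi_d &= X_i\xi^*_0,\\ \frac{\eta_d(\theta_0)}{\varphi}\frac{\langle\xi^*_d,\xi^*_d\rangle}{\langle\xi_d,\xi^*_d\rangle}\sum_{r=0}^dX_rE^*_dE_0\eta^*_{d-r}(A^* )\cdot\tau^*_i(A^* )\xi_d &= X_i\xi^*_d,\\ \frac{\langle\xi^*_0,\xi^*_0\rangle}{\langle\xi_d,\xi^*_0\rangle}\sum_{r=0}^d\frac{X_{d-r}E^*_0\eta_r(A)}{\phi_1\phi_2\cdots\phi_r}\cdot\tau^*_{d-i}(A^*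 )\xi_d &= X_i\xi^*_0,\\ \frac{\eta_d(\theta_0)}{\varphi}\frac{\langle\xi^*_d,\xi^*_d\rangle}{\langle\xi_d,\xi^*_d\rangle}\sum_{r=0}^dX_{d-r}E^*_dE_0\eta^*_{d-r}(A^* )\cdot\tau^*_{d-i}(A^* )\xi_d &= X_i\xi^*_d. \end{align*} (ii) Let $\{X_i\}_{i=0}^d$ denote one of the sequences $\{E^*_i\}_{i=0}^d$, $\{E^*_{d-i}\}_{i=0}^d$, $\{\tau^*_i(A^* )\}_{i=0}^d$, $\{\tau^*_{d-i}(A^* )\}_{i=0}^d$, $\{\eta^*_i(A^* )\}_{i=0}^d$, $\{\eta^*_{d-i}(A^* )\}_{i=0}^d$. Then for $0\le i\le d$, \begin{align*} \frac{\eta_d(\theta_0)}{\phi}\frac{\langle\xi_0,\xi^*_0\rangle}{\langle\xi_d,\xi^*_0\rangle}\sum_{r=0}^dX_rE_0\eta^*_{d-r}(A^* )\cdot\tau^*_i(A^* )\xi_d &= X_i\xi_0,\\ \frac{1}{\mathrm{tr}(E_dE^*_0)}\sum_{r=0}^d\frac{X_rE_dE^*_0\eta_r(A)}{\phi_1\phi_2\cdots\phi_r}\cdot\tau^*_i(A^* )\xi_d &= X_i\xi_d,\\ \frac{\eta_d(\theta_0)}{\phi}\frac{\langle\xi_0,\xi^*_0\rangle}{\langle\xi_d,\xi^*_0\rangle}\sum_{r=0}^dX_{d-r}E_0\eta^*_{d-r}(A^* )\cdot\tau^*_{d-i}(A^* )\xi_d &= X_i\xi_0,\\ \frac{1}{\mathrm{tr}(E_dE^*_0)}\sum_{r=0}^d\frac{X_{d-r}E_dE^*_0\eta_r(A)}{\phi_1\phi_2\cdots\phi_r}\cdot\tau^*_{d-i}(A^*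 )\xi_d &= X_i\xi_d. \end{align*}
   Context: Let $\mathbb{K}$ be a field, $d\ge 0$ an integer, $\mathcal{A}$ a $\mathbb{K}$-algebra isomorphic to the algebra $\mathrm{Mat}_{d+1}(\mathbb{K})$ of all $(d+1)\times(d+1)$ matrices over $\mathbb{K}$, $I$ its identity, and $V$ an irreducible left $\mathcal{A}$-module (so $\dim V=d+1$). For $X\in\mathcal{A}$, $\mathrm{tr}(X)$ is the trace of $X$ (equivalently of its action on $V$). Leonard system. An element of $\mathcal{A}$ is multiplicity-free if it has $d+1$ mutually distinct eigenvalues in $\mathbb{K}$. If $A$ is multiplicity-free with eigenvalues $\theta_0,\dots,\theta_d$, the primitive idempotent of $A$ associated with $\theta_i$ is $E_i=\prod_{0\le j\le d,\,j\ne i}\frac{A-\theta_jI}{\theta_i-\theta_j}$ (the projection onto the one-dimensional $\theta_i$-eigenspace $E_iV$). A Leonard system in $\mathcal{A}$ is a sequence $\Phi=(A;\{E_i\}_{i=0}^d;A^*;\{E^*_i\}_{i=0}^d)$ such that: (i) each of $A,A^*$ is a multiplicity-free element of $\mathcal{A}$ ($A^*$ is just another element; no adjoint is meant); (ii) $\{E_i\}_{i=0}^d$ is an ordering of the primitive idempotents of $A$; (iii) $\{E^*_i\}_{i=0}^d$ is an ordering of the primitive idempotents of $A^*$; (iv) for $0\le i,j\le d$, $E_iA^*E_j=0$ if $|i-j|>1$ and $E_iA^*E_j\ne0$ if $|i-j|=1$; (v) for $0\le i,j\le d$, $E^*_iAE^*_j=0$ if $|i-j|>1$ and $E^*_iAE^*_j\neq0$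 if $|i-j|=1$. Parameter array. $\theta_i$ (resp. $\theta^*_i$) is the eigenvalue of $A$ (resp. $A^*$) associated with $E_i$ (resp. $E^*_i$). For $0\le i\le d$ define polynomials $\tau_i=(\lambda-\theta_0)(\lambda-\theta_1)\cdots(\lambda-\theta_{i-1})$, $\eta_i=(\lambda-\theta_d)(\lambda-\theta_{d-1})\cdots(\lambda-\theta_{d-i+1})$, $\tau^*_i=(\lambda-\theta^*_0)(\lambda-\theta^*_1)\cdots(\lambda-\theta^*_{i-1})$, $\eta^*_i=(\lambda-\theta^*_d)(\lambda-\theta^*_{d-1})\cdots(\lambda-\theta^*_{d-i+1})$. For $1\le i\le d$ define $\varphi_i=(\theta^*_0-\theta^*_i)\frac{\mathrm{tr}(\tau_i(A)E^*_0)}{\mathrm{tr}(\tau_{i-1}(A)E^*_0)}$ and $\phi_i=(\theta^*_0-\theta^*_i)\frac{\mathrm{tr}(\eta_i(A)E^*_0)}{\mathrm{tr}(\eta_{i-1}(A)E^*_0)}$; the denominators, and all $\varphi_i,\phi_i$, are known to be nonzero. The parameter array of $\Phi$ is $(\{\theta_i\}_{i=0}^d;\{\theta^*_i\}_{i=0}^d;\{\varphi_i\}_{i=1}^d;\{\phi_i\}_{i=1}^d)$. Abbreviate $\varphi=\varphi_1\varphi_2\cdots\varphi_d$ and $\phi=\phi_1\phi_2\cdots\phi_d$. Empty products are $1$. Bilinear form. There is a unique antiautomorphism $\dagger$ of $\mathcal{A}$ ($\mathbb{K}$-linear bijection with $(XY)^\dagger=Y^\dagger X^\dagger$) with $A^\dagger=A$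 and $A^{*\dagger}=A^*$. $\langle\,,\rangle$ denotes a fixed nonzero bilinear form on $V$ with $\langle Xu,v\rangle=\langle u,X^\dagger v\rangle$ for all $X\in\mathcal{A}$, $u,v\in V$; it exists, is unique up to a nonzero scalar factor, and is nondegenerate and symmetric. All scalars appearing in denominators (traces and inner products) are known to be nonzero. The notation $T\cdot v$ means the element $T\in\mathcal{A}$ (including the scalar prefactor and the whole sum) applied to $v\in V$. *)

theory Defs
  imports "Jordan_Normal_Form.Char_Poly"
begin

text \<open>
  Throughout, \<open>scaleA\<close> is the scalar multiplication of the algebra, \<open>h\<close> is an isomorphism of it
  onto the algebra of (d+1) x (d+1) matrices, and \<open>scaleV\<close>, \<open>act\<close> are the scalar multiplication and
  the algebra action of the module. Finite sequences indexed by 0..d are functions on \<open>nat\<close> of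
  which only the values at indices up to \<open>d\<close> matter.
\<close>

locale full_matrix_algebra = vector_space scaleA
  for scaleA :: "'k::field \<Rightarrow> 'a::ring_1 \<Rightarrow> 'a" +
  fixes d :: nat and h :: "'a \<Rightarrow> 'k mat"
  assumes scale_mult_left: "scaleA c (x * y) = scaleA c x * y"
    and scale_mult_right: "scaleA c (x * y) = x * scaleA c y"
    and iso_bij: "bij_betw h UNIV (carrier_mat (Suc d) (Suc d))"
    and iso_add: "h (x + y) = h x + h y"
    and iso_mult: "h (x * y) = h x * h y"
    and iso_one: "h 1 = 1\<^sub>m (Suc d)"
    and iso_scale: "h (scaleA c x) = c \<cdot>\<^sub>m h x"

locale irreducible_left_module = vector_space scaleV
  for scaleV :: "'k::field \<Rightarrow> 'v::ab_group_add \<Rightarrow> 'v" +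
  fixes scaleA :: "'k \<Rightarrow> 'a::ring_1 \<Rightarrow> 'a" and act :: "'a \<Rightarrow> 'v \<Rightarrow> 'v"
  assumes act_add_left: "act (x + y) v = act x v + act y v"
    and act_add_right: "act x (u + v) = act x u + act x v"
    and act_mult: "act (x * y) v = act x (act y v)"
    and act_one: "act 1 v = v"
    and act_scale: "act (scaleA c x) v = scaleV c (act x v)"
    and nontrivial: "\<exists>v::'v. v \<noteq> 0"
    and irreducible: "\<lbrakk>0 \<in> W; \<And>u v. u \<in> W \<Longrightarrow> v \<in> W \<Longrightarrow> u + v \<in> W; \<And>x v. v \<in> W \<Longrightarrow> act x v \<in> W\<rbrakk>
      \<Longrightarrow> W = {0} \<or> W = UNIV"

definition mat_trace :: "'k::comm_ring_1 mat \<Rightarrow> 'k" where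
  "mat_trace M = (\<Sum>i<dim_row M. M $$ (i, i))"

definition poly_alg :: "('k::field \<Rightarrow> 'a::ring_1 \<Rightarrow> 'a) \<Rightarrow> 'k poly \<Rightarrow> 'a \<Rightarrow> 'a" where
  "poly_alg scaleA p X = (\<Sum>i\<le>degree p. scaleA (poly.coeff p i) (X ^ i))"

definition alg_eigenvalues :: "('a \<Rightarrow> 'k::field mat) \<Rightarrow> 'a \<Rightarrow> 'k set" where
  "alg_eigenvalues h X = {t. eigenvalue (h X) t}"

definition multiplicity_free :: "nat \<Rightarrow> ('a \<Rightarrow> 'k::field mat) \<Rightarrow> 'a \<Rightarrow> bool" where
  "multiplicity_free d h X \<longleftrightarrow> card (alg_eigenvalues h X) = Suc d"

text \<open>The product of (X - s I)/(t - s) over the eigenvalues s of X other than t. Its factors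
  commute, but the algebra does not, so the product is formed in the polynomial ring and then
  evaluated at X.\<close>

definition primitive_idempotent ::
  "('k::field \<Rightarrow> 'a::ring_1 \<Rightarrow> 'a) \<Rightarrow> ('a \<Rightarrow> 'k mat) \<Rightarrow> 'a \<Rightarrow> 'k \<Rightarrow> 'a" where
  "primitive_idempotent scaleA h X t =
     poly_alg scaleA (\<Prod>s\<in>alg_eigenvalues h X - {t}. Polynomial.smult (1 / (t - s)) [:- s, 1:]) X"

definition primitive_idempotents_ordering ::
  "('k::field \<Rightarrow> 'a::ring_1 \<Rightarrow> 'a) \<Rightarrow> nat \<Rightarrow> ('a \<Rightarrow> 'k mat) \<Rightarrow> 'a \<Rightarrow> (nat \<Rightarrow> 'a) \<Rightarrow> bool" where
  "primitive_idempotents_ordering scaleA d h X E \<longleftrightarrow>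
     bij_betw E {0..d} (primitive_idempotent scaleA h X ` alg_eigenvalues h X)"

text \<open>The arguments \<open>As\<close>, \<open>Es\<close> stand for the starred entries.\<close>

definition leonard_system ::
  "('k::field \<Rightarrow> 'a::ring_1 \<Rightarrow> 'a) \<Rightarrow> nat \<Rightarrow> ('a \<Rightarrow> 'k mat) \<Rightarrow>
   'a \<Rightarrow> (nat \<Rightarrow> 'a) \<Rightarrow> 'a \<Rightarrow> (nat \<Rightarrow> 'a) \<Rightarrow> bool" where
  "leonard_system scaleA d h A E As Es \<longleftrightarrow>
     multiplicity_free d h A \<and> multiplicity_free d h As \<and>
     primitive_idempotents_ordering scaleA d h A E \<and>
     primitive_idempotents_ordering scaleA d h As Es \<and>
     (\<forall>i\<le>d. \<forall>j\<le>d.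
        (\<bar>int i - int j\<bar> > 1 \<longrightarrow> E i * As * E j = 0) \<and>
        (\<bar>int i - int j\<bar> = 1 \<longrightarrow> E i * As * E j \<noteq> 0)) \<and>
     (\<forall>i\<le>d. \<forall>j\<le>d.
        (\<bar>int i - int j\<bar> > 1 \<longrightarrow> Es i * A * Es j = 0) \<and>
        (\<bar>int i - int j\<bar> = 1 \<longrightarrow> Es i * A * Es j \<noteq> 0))"

definition tau :: "(nat \<Rightarrow> 'k::field) \<Rightarrow> nat \<Rightarrow> 'k poly" where
  "tau \<theta> i = (\<Prod>j<i. [:- \<theta> j, 1:])"

definition eta :: "nat \<Rightarrow> (nat \<Rightarrow> 'k::field) \<Rightarrow> nat \<Rightarrow> 'k poly" where
  "eta d \<theta> i = (\<Prod>j<i. [:- \<theta> (d - j), 1:])"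

definition parameter_array ::
  "('k::field \<Rightarrow> 'a::ring_1 \<Rightarrow> 'a) \<Rightarrow> nat \<Rightarrow> ('a \<Rightarrow> 'k mat) \<Rightarrow>
   'a \<Rightarrow> (nat \<Rightarrow> 'a) \<Rightarrow> 'a \<Rightarrow> (nat \<Rightarrow> 'a) \<Rightarrow>
   (nat \<Rightarrow> 'k) \<Rightarrow> (nat \<Rightarrow> 'k) \<Rightarrow> (nat \<Rightarrow> 'k) \<Rightarrow> (nat \<Rightarrow> 'k) \<Rightarrow> bool" where
  "parameter_array scaleA d h A E As Es \<theta> \<theta>s vphi phi \<longleftrightarrow>
     (\<forall>i\<le>d. \<theta> i \<in> alg_eigenvalues h A \<and> E i = primitive_idempotent scaleA h A (\<theta> i)) \<and>
     (\<forall>i\<le>d. \<theta>s i \<in> alg_eigenvalues h As \<and> Es i = primitive_idempotent scaleA h As (\<theta>s i)) \<and>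
     (\<forall>i\<in>{1..d}. vphi i = (\<theta>s 0 - \<theta>s i) *
        (mat_trace (h (poly_alg scaleA (tau \<theta> i) A * Es 0)) /
         mat_trace (h (poly_alg scaleA (tau \<theta> (i - 1)) A * Es 0)))) \<and>
     (\<forall>i\<in>{1..d}. phi i = (\<theta>s 0 - \<theta>s i) *
        (mat_trace (h (poly_alg scaleA (eta d \<theta> i) A * Es 0)) /
         mat_trace (h (poly_alg scaleA (eta d \<theta> (i - 1)) A * Es 0))))"

definition antiautomorphism ::
  "('k::field \<Rightarrow> 'a::ring_1 \<Rightarrow> 'a) \<Rightarrow> ('a \<Rightarrow> 'a) \<Rightarrow> bool" where
  "antiautomorphism scaleA f \<longleftrightarrow>
     Vector_Spaces.linear scaleA scaleA f \<and> bij f \<and> (\<forall>x y. f (x * y) = f y * f x)"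

definition bilinear_form ::
  "('k::field \<Rightarrow> 'v::ab_group_add \<Rightarrow> 'v) \<Rightarrow> ('v \<Rightarrow> 'v \<Rightarrow> 'k) \<Rightarrow> bool" where
  "bilinear_form scaleV B \<longleftrightarrow>
     (\<forall>v. Vector_Spaces.linear scaleV (*) (\<lambda>u. B u v)) \<and>
     (\<forall>u. Vector_Spaces.linear scaleV (*) (\<lambda>v. B u v))"

end

theory Submission
  imports Defs
begin

text \<open>
  The elements \<open>X\<^sub>r\<close> of the theorem can be arbitrary. In each of the identities the sum runs over
  products \<open>X\<^sub>r Z\<^sub>r\<close>, and what has to be shown is that \<open>Z\<^sub>r\<close> sends \<open>\<tau>\<^sup>*\<^sub>i(A\<^sup>*) \<xi>\<^sub>d\<close> to \<open>0\<close> for \<open>r \<noteq> i\<close>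
  and to a known multiple of the target vector for \<open>r = i\<close>, so that the sum collapses to one term
  (\<open>collapse\<close>). The identities with reflected indices are the same statement for the sequence
  \<open>X\<^bsub>d-r\<^esub>\<close> and the index \<open>d - i\<close>.

  Writing \<open>\<xi>\<^sub>d = E\<^sub>d \<xi>\<^sub>d\<close> turns these facts into identities in the algebra. The first one is
  \<open>E\<^sup>*\<^sub>0 \<eta>\<^sub>r(A) \<tau>\<^sup>*\<^sub>i(A\<^sup>*) E\<^sub>d = \<delta>\<^bsub>ri\<^esub> phi\<^sub>1 \<dots> phi\<^sub>r E\<^sup>*\<^sub>0 E\<^sub>d\<close> (\<open>Es0_eta_tau_Ed\<close>). It vanishes
  off the diagonal because \<open>A\<close> and \<open>A\<^sup>*\<close> act tridiagonally on each other's eigenspaces. Those band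
  estimates also show that for \<open>r = i\<close> the left side is the same for every monic polynomial of degree
  \<open>r\<close> in place of \<open>\<tau>\<^sup>*\<^sub>r\<close>. The choice \<open>(\<lambda> - \<theta>\<^sup>*\<^sub>1) \<dots> (\<lambda> - \<theta>\<^sup>*\<^sub>r)\<close> leaves only the component
  \<open>E\<^sup>*\<^sub>0 \<eta>\<^sub>r(A) E\<^sup>*\<^sub>0\<close>, a multiple of \<open>E\<^sup>*\<^sub>0\<close> by a trace, and the definition of \<open>phi\<^sub>k\<close> is made such that
  the product \<open>phi\<^sub>1 \<dots> phi\<^sub>r\<close> telescopes to precisely this value (\<open>prod_split\<close>). The second identity,
  \<open>E\<^sub>0 \<eta>\<^sup>*\<^bsub>d-r\<^esub>(A\<^sup>*) \<tau>\<^sup>*\<^sub>i(A\<^sup>*) E\<^sub>d = \<delta>\<^bsub>ri\<^esub> E\<^sub>0 (A\<^sup>*)\<^sup>d E\<^sub>d\<close> (\<open>E0_eta_tau_Ed\<close>), holds since the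
  polynomial either has all \<open>\<theta>\<^sup>*\<^sub>m\<close> as roots, or is monic of degree \<open>d\<close>, or has smaller degree.

  The element \<open>E\<^sub>0 (A\<^sup>*)\<^sup>d E\<^sub>d\<close> is then evaluated from both ends. Multiplied by \<open>E\<^sup>*\<^sub>0\<close> it falls under the
  first identity with \<open>r = i = d\<close>, because \<open>\<eta>\<^sub>d(A) = \<eta>\<^sub>d(\<theta>\<^sub>0) E\<^sub>0\<close>. Multiplied by \<open>E\<^sup>*\<^sub>d\<close> it gives
  \<open>tr(E\<^sup>*\<^sub>d E\<^sub>0)\<close>, which has to be compared with \<open>tr(E\<^sub>d E\<^sup>*\<^sub>0)\<close>, the trace to which the
  product \<open>vphi\<^sub>1 \<dots> vphi\<^sub>d\<close> telescopes (\<open>prod_first_split\<close>, \<open>corner_traces\<close>).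

  The traces, and the inner products between vectors of different eigenspaces, are nonzero for one
  reason: the primitive idempotents have rank one, so that \<open>a e b \<noteq> 0\<close> whenever \<open>a e \<noteq> 0\<close> and
  \<open>e b \<noteq> 0\<close> (\<open>rank_one_cancel\<close>). Finally, irreducibility of the module makes the image of a rank-one idempotent \<open>e\<close> a line, and if \<open>e\<close> is fixed by the
  antiautomorphism, the form computes the coordinate on that line (\<open>act_idempotent\<close>); this brings
  in the quotients of inner products.
\<close>

section \<open>Rank-one elements of a matrix algebra\<close>

context full_matrix_algebra
begin

abbreviation tr :: "'a \<Rightarrow> 'k" where "tr x \<equiv> mat_trace (h x)"
abbreviation ev :: "'k poly \<Rightarrow> 'a \<Rightarrow> 'a" where "ev \<equiv> poly_alg scaleA"

lemma h_carrier [simp]: "h x \<in> carrier_mat (Suc d) (Suc d)"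
  using iso_bij by (auto simp: bij_betw_def)

lemma h_dims [simp]: "dim_row (h x) = Suc d" "dim_col (h x) = Suc d"
  by (rule carrier_matD[OF h_carrier])+

lemma h_entry_eqI:
  assumes "\<And>k l. k \<le> d \<Longrightarrow> l \<le> d \<Longrightarrow> h x $$ (k, l) = h y $$ (k, l)"
  shows "x = y"
proof -
  have "h x = h y" by (rule eq_matI) (auto simp: assms)
  then show ?thesis using iso_bij by (auto simp: bij_betw_def inj_on_def)
qed

lemma h_mult_entry:
  "k \<le> d \<Longrightarrow> l \<le> d \<Longrightarrow> h (x * y) $$ (k, l) = (\<Sum>p\<le>d. h x $$ (k, p) * h y $$ (p, l))"
  by (simp add: iso_mult scalar_prod_def atLeast0LessThan lessThan_Suc_atMost)

lemma h_scale_entry: "k \<le> d \<Longrightarrow> l \<le> d \<Longrightarrow> h (scaleA c x) $$ (k, l) = c * h x $$ (k, l)"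
  by (simp add: iso_scale)

lemma h_zero: "h 0 = 0\<^sub>m (Suc d) (Suc d)"
proof -
  have "h 0 = h (scaleA 0 0)" by simp
  also have "\<dots> = 0\<^sub>m (Suc d) (Suc d)" unfolding iso_scale by (rule eq_matI) auto
  finally show ?thesis .
qed

lemma tr_alt: "tr x = (\<Sum>k\<le>d. h x $$ (k, k))"
  by (simp add: mat_trace_def lessThan_Suc_atMost)

lemma tr_commute: "tr (x * y) = tr (y * x)"
proof -
  have "tr (x * y) = (\<Sum>k\<le>d. \<Sum>p\<le>d. h x $$ (k, p) * h y $$ (p, k))"
    unfolding tr_alt by (intro sum.cong refl) (simp add: h_mult_entry)
  also have "\<dots> = (\<Sum>p\<le>d. \<Sum>k\<le>d. h y $$ (p, k) * h x $$ (k, p))"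
    by (subst sum.swap) (simp add: mult.commute)
  also have "\<dots> = tr (y * x)"
    unfolding tr_alt by (intro sum.cong refl) (simp add: h_mult_entry)
  finally show ?thesis .
qed

lemma tr_scale: "tr (scaleA c x) = c * tr x"
  unfolding tr_alt by (simp add: h_scale_entry sum_distrib_left)

text \<open>
  The matrix of \<open>e\<close> is an outer product, so zero counts as well. A factorisation rather than a
  statement about the dimension of the image is what entrywise computation can use.
\<close>

definition rank_one :: "'a \<Rightarrow> bool" where
  "rank_one e \<longleftrightarrow> (\<exists>v w. \<forall>k\<le>d. \<forall>l\<le>d. h e $$ (k, l) = v k * w l)"

text \<open>
  With \<open>e = v w\<^sup>T\<close> the product \<open>e x e\<close> is \<open>v (w\<^sup>T x v) w\<^sup>T\<close>, and the scalar in the middle is the trace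
  of \<open>x v w\<^sup>T\<close>.
\<close>

lemma rank_one_compress:
  assumes "rank_one e"
  shows "e * x * e = scaleA (tr (x * e)) e"
proof -
  obtain v w where e: "\<And>k l. k \<le> d \<Longrightarrow> l \<le> d \<Longrightarrow> h e $$ (k, l) = v k * w l"
    using assms unfolding rank_one_def by blast
  have t: "tr (x * e) = (\<Sum>q\<le>d. \<Sum>p\<le>d. h x $$ (q, p) * v p * w q)"
    unfolding tr_alt by (intro sum.cong refl) (simp add: h_mult_entry e mult.assoc)
  show ?thesis
  proof (rule h_entry_eqI)
    fix k l assume kl: "k \<le> d" "l \<le> d"
    have "h (e * x * e) $$ (k, l) = (\<Sum>p\<le>d. (\<Sum>q\<le>d. v k * w q * h x $$ (q, p)) * (v p * w l))"
      using kl by (simp add: h_mult_entry e)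
    also have "\<dots> = (\<Sum>p\<le>d. \<Sum>q\<le>d. (h x $$ (q, p) * v p * w q) * (v k * w l))"
      by (simp add: sum_distrib_right sum_distrib_left mult_ac)
    also have "\<dots> = tr (x * e) * (v k * w l)"
      unfolding t by (subst sum.swap) (simp add: sum_distrib_right)
    finally show "h (e * x * e) $$ (k, l) = h (scaleA (tr (x * e)) e) $$ (k, l)"
      using kl by (simp add: h_scale_entry e)
  qed
qed

text \<open>
  With \<open>e = v w\<^sup>T\<close> the product \<open>a e b\<close> is the outer product of \<open>a v\<close> and \<open>w\<^sup>T b\<close>, and an outer product of
  nonzero vectors is nonzero. Every claim below that some product or trace does not vanish comes
  from this cancellation property.
\<close>

lemma rank_one_cancel:
  assumes "rank_one e" "a * e \<noteq> 0" "e * b \<noteq> 0"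
  shows "a * e * b \<noteq> 0"
proof
  assume 0: "a * e * b = 0"
  obtain v w where e: "\<And>k l. k \<le> d \<Longrightarrow> l \<le> d \<Longrightarrow> h e $$ (k, l) = v k * w l"
    using assms(1) unfolding rank_one_def by blast
  define f where "f k = (\<Sum>p\<le>d. h a $$ (k, p) * v p)" for k
  define g where "g l = (\<Sum>p\<le>d. w p * h b $$ (p, l))" for l
  have ae: "h (a * e) $$ (k, l) = f k * w l" if "k \<le> d" "l \<le> d" for k l
    using that by (simp add: h_mult_entry e f_def sum_distrib_right mult.assoc)
  have eb: "h (e * b) $$ (k, l) = v k * g l" if "k \<le> d" "l \<le> d" for k l
    using that by (simp add: h_mult_entry e g_def sum_distrib_left mult_ac)
  obtain k where k: "k \<le> d" "f k \<noteq> 0"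
    using assms(2) h_entry_eqI[of "a * e" 0] by (auto simp: ae h_zero)
  obtain l where l: "l \<le> d" "g l \<noteq> 0"
    using assms(3) h_entry_eqI[of "e * b" 0] by (auto simp: eb h_zero)
  have "h (a * e * b) $$ (k, l) = (\<Sum>p\<le>d. h (a * e) $$ (k, p) * h b $$ (p, l))"
    using k l by (intro h_mult_entry)
  also have "\<dots> = f k * g l"
    using k by (simp add: ae g_def sum_distrib_left mult.assoc)
  finally have "h (a * e * b) $$ (k, l) = f k * g l" .
  with 0 k l show False by (simp add: h_zero)
qed

end

section \<open>Evaluating polynomials in the algebra\<close>

context full_matrix_algebra
begin

lemma scale_mult_l [simp]: "scaleA c x * y = scaleA c (x * y)"
  by (simp add: scale_mult_left)

lemma scale_mult_r [simp]: "x * scaleA c y = scaleA c (x * y)"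
  by (simp add: scale_mult_right)

lemma ev_0 [simp]: "ev 0 x = 0"
  by (simp add: poly_alg_def)

lemma ev_bound: "degree p \<le> n \<Longrightarrow> ev p x = (\<Sum>i\<le>n. scaleA (coeff p i) (x ^ i))"
  unfolding poly_alg_def
  by (rule sum.mono_neutral_left) (auto simp: coeff_eq_0)

lemma ev_pCons [simp]: "ev (pCons a p) x = scaleA a 1 + x * ev p x"
proof -
  have "ev (pCons a p) x = (\<Sum>i\<le>Suc (degree p). scaleA (coeff (pCons a p) i) (x ^ i))"
    by (rule ev_bound) (rule degree_pCons_le)
  also have "\<dots> = scaleA a 1 + (\<Sum>i\<le>degree p. scaleA (coeff p i) (x ^ Suc i))"
    by (subst sum.atMost_Suc_shift) simp
  also have "(\<Sum>i\<le>degree p. scaleA (coeff p i) (x ^ Suc i)) = x * ev p x"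
    by (simp add: poly_alg_def sum_distrib_left)
  finally show ?thesis .
qed

lemma ev_add: "ev (p + q) x = ev p x + ev q x"
proof -
  let ?n = "max (degree p) (degree q)"
  have "degree (p + q) \<le> ?n" by (rule degree_add_le_max)
  then show ?thesis
    by (simp add: ev_bound[where n = ?n] scale_left_distrib sum.distrib)
qed

lemma ev_smult: "ev (Polynomial.smult c p) x = scaleA c (ev p x)"
  by (induction p) (simp_all add: scale_right_distrib)

lemma ev_diff: "ev (p - q) x = ev p x - ev q x"
  using ev_add[of "p - q" q x] by (simp add: algebra_simps)

lemma ev_mult: "ev (p * q) x = ev p x * ev q x"
  by (induction p) (simp_all add: ev_add ev_smult distrib_right mult.assoc)

lemma ev_1 [simp]: "ev 1 x = 1"
  using ev_pCons[of 1 0 x] by (simp add: one_pCons)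

lemma ev_eigen_right:
  assumes "x * e = scaleA t e"
  shows "ev p x * e = scaleA (poly p t) e"
  by (induction p) (simp_all add: distrib_right mult.assoc assms scale_left_distrib mult.commute)

lemma ev_eigen_left:
  assumes "e * x = scaleA t e"
  shows "e * ev p x = scaleA (poly p t) e"
  by (induction p) (simp_all add: distrib_left mult.assoc[symmetric] assms scale_left_distrib mult.commute)

text \<open>
  Working with the action on column vectors keeps the dimension side conditions of matrix arithmetic
  out of the computations with eigenvectors.
\<close>

lemma h_vec:
  assumes "v \<in> carrier_vec (Suc d)"
  shows "h 0 *\<^sub>v v = 0\<^sub>v (Suc d)"
    and "h 1 *\<^sub>v v = v"
    and "h (x + y) *\<^sub>v v = h x *\<^sub>v v + h y *\<^sub>v v"
    and "h (x * y) *\<^sub>v v = h x *\<^sub>v (h y *\<^sub>v v)"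
    and "h (scaleA c x) *\<^sub>v v = c \<cdot>\<^sub>v (h x *\<^sub>v v)"
proof -
  show "h 0 *\<^sub>v v = 0\<^sub>v (Suc d)"
    using assms by (intro eq_vecI) (auto simp: h_zero)
  show "h 1 *\<^sub>v v = v" using assms by (simp add: iso_one)
  show "h (x + y) *\<^sub>v v = h x *\<^sub>v v + h y *\<^sub>v v"
    unfolding iso_add by (rule add_mult_distrib_mat_vec[OF h_carrier h_carrier assms])
  show "h (x * y) *\<^sub>v v = h x *\<^sub>v (h y *\<^sub>v v)"
    unfolding iso_mult by (rule assoc_mult_mat_vec[OF h_carrier h_carrier assms])
  have "row (h x) i \<in> carrier_vec (Suc d)" for i
    by (rule carrier_vecI) simp
  then show "h (scaleA c x) *\<^sub>v v = c \<cdot>\<^sub>v (h x *\<^sub>v v)"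
    unfolding iso_scale using assms by (intro eq_vecI) (auto simp: smult_scalar_prod_distrib)
qed

lemma h_ev_eigenvector:
  assumes v: "v \<in> carrier_vec (Suc d)" "h x *\<^sub>v v = t \<cdot>\<^sub>v v"
  shows "h (ev p x) *\<^sub>v v = poly p t \<cdot>\<^sub>v v"
proof (induction p)
  case 0
  show ?case using v(1) by (simp add: h_vec(1)) (intro eq_vecI; simp)
next
  case (pCons a p)
  have "h x *\<^sub>v (poly p t \<cdot>\<^sub>v v) = (poly p t * t) \<cdot>\<^sub>v v"
    using v by (simp add: mult_mat_vec[OF h_carrier] smult_smult_assoc)
  then show ?case
    using v(1) by (simp add: h_vec pCons.IH add_smult_distrib_vec mult.commute)
qed

end

section \<open>Elements with simple spectrum\<close>

text \<open>
  The relations between \<open>X\<close>, its eigenvalues and its primitive idempotents from which all later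
  calculations start. No interpolation polynomial occurs in them, and they are preserved by
  permuting the indices.
\<close>

locale simple_spectrum = full_matrix_algebra scaleA d h
  for scaleA :: "'k::field \<Rightarrow> 'a::ring_1 \<Rightarrow> 'a" and d :: nat and h :: "'a \<Rightarrow> 'k mat" +
  fixes X :: 'a and e :: "nat \<Rightarrow> 'a" and t :: "nat \<Rightarrow> 'k"
  assumes inj_t: "inj_on t {..d}"
    and X_e: "i \<le> d \<Longrightarrow> X * e i = scaleA (t i) (e i)"
    and e_e: "\<lbrakk>i \<le> d; j \<le> d\<rbrakk> \<Longrightarrow> e i * e j = (if i = j then e i else 0)"
    and sum_e: "(\<Sum>i\<le>d. e i) = 1"
    and e_nonzero: "i \<le> d \<Longrightarrow> e i \<noteq> 0"
    and e_rank_one: "i \<le> d \<Longrightarrow> rank_one (e i)"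
begin

lemma insert_sum: "a * b = (\<Sum>m\<le>d. a * e m * b)"
proof -
  have "a * b = a * (\<Sum>m\<le>d. e m) * b" by (simp add: sum_e)
  then show ?thesis by (simp add: sum_distrib_left sum_distrib_right)
qed

text \<open>
  The basic manipulation below: a factor \<open>1 = \<Sum>\<^sub>m e\<^sub>m\<close> is inserted between two elements, and vanishing
  arguments leave a single summand.
\<close>

lemma insert_one:
  assumes "l \<le> d" "\<And>m. m \<le> d \<Longrightarrow> m \<noteq> l \<Longrightarrow> a * e m = 0 \<or> e m * b = 0"
  shows "a * b = a * e l * b"
proof -
  have "(\<Sum>m\<le>d. a * e m * b) = (\<Sum>m\<in>{l}. a * e m * b)"
  proof (rule sum.mono_neutral_right)
    show "\<forall>m\<in>{..d} - {l}. a * e m * b = 0"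
      using assms(2) by (metis DiffE atMost_iff insertI1 mult.assoc mult_zero_left mult_zero_right)
  qed (use assms(1) in auto)
  then show ?thesis using insert_sum[of a b] by simp
qed

lemma e_X:
  assumes "i \<le> d"
  shows "e i * X = scaleA (t i) (e i)"
proof -
  have "e i * X * 1 = e i * X * e i * 1"
    using assms by (intro insert_one) (auto simp: mult.assoc X_e e_e)
  then show ?thesis using assms by (simp add: mult.assoc X_e e_e)
qed

lemma ev_e: "i \<le> d \<Longrightarrow> ev p X * e i = scaleA (poly p (t i)) (e i)"
  by (rule ev_eigen_right) (rule X_e)

lemma e_ev: "i \<le> d \<Longrightarrow> e i * ev p X = scaleA (poly p (t i)) (e i)"
  by (rule ev_eigen_left) (rule e_X)

lemma ev_single:
  assumes "k \<le> d" "\<And>j. j \<le> d \<Longrightarrow> j \<noteq> k \<Longrightarrow> poly p (t j) = 0"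
  shows "ev p X = scaleA (poly p (t k)) (e k)"
proof -
  have "ev p X * 1 = ev p X * e k * 1"
    using assms by (intro insert_one) (auto simp: ev_e)
  then show ?thesis using assms by (simp add: ev_e)
qed

lemma ev_vanish:
  assumes "\<And>j. j \<le> d \<Longrightarrow> poly p (t j) = 0"
  shows "ev p X = 0"
  using ev_single[of 0 p] assms by simp

lemma compress: "i \<le> d \<Longrightarrow> e i * x * e i = scaleA (tr (x * e i)) (e i)"
  by (rule rank_one_compress) (rule e_rank_one)

lemma cancel: "\<lbrakk>i \<le> d; a * e i \<noteq> 0; e i * b \<noteq> 0\<rbrakk> \<Longrightarrow> a * e i * b \<noteq> 0"
  by (rule rank_one_cancel) (auto intro: e_rank_one)

lemma tr_e: "i \<le> d \<Longrightarrow> tr (e i) = 1"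
  using compress[of i 1] e_nonzero[of i] scale_right_imp_eq[of "e i" 1 "tr (e i)"]
  by (simp add: e_e)

lemma reverse: "simple_spectrum scaleA d h X (\<lambda>i. e (d - i)) (\<lambda>i. t (d - i))"
proof unfold_locales
  show "inj_on (\<lambda>i. t (d - i)) {..d}"
    unfolding inj_on_def
  proof (intro ballI impI)
    fix i j assume ij: "i \<in> {..d}" "j \<in> {..d}" "t (d - i) = t (d - j)"
    then have "d - i = d - j" using inj_onD[OF inj_t, of "d - i" "d - j"] by simp
    then show "i = j" using ij by simp
  qed
  show "(\<Sum>i\<le>d. e (d - i)) = 1"
    by (subst sum_e[symmetric], rule sum.reindex_bij_witness[where i = "\<lambda>i. d - i" and j = "\<lambda>i. d - i"]) auto
qed (auto simp: X_e e_e e_nonzero e_rank_one)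

end

text \<open>
  Let \<open>P\<close> have as columns eigenvectors \<open>v\<^sub>j\<close> for the \<open>d + 1\<close> distinct eigenvalues. By Lagrange
  interpolation \<open>e\<^sub>i v\<^sub>j = \<delta>\<^bsub>ij\<^esub> v\<^sub>j\<close>, which forces \<open>P\<close> to be invertible. Hence an element is determined by
  its action on the \<open>v\<^sub>j\<close>, which yields the algebraic relations, and \<open>e\<^sub>i\<close> is the outer product of \<open>v\<^sub>i\<close>
  with row \<open>i\<close> of the inverse of \<open>P\<close>.
\<close>

lemma (in full_matrix_algebra) simple_spectrum_primitive_idempotents:
  assumes mf: "multiplicity_free d h X"
    and ord: "primitive_idempotents_ordering scaleA d h X e"
    and t: "\<And>i. i \<le> d \<Longrightarrow> t i \<in> alg_eigenvalues h X"
    and e: "\<And>i. i \<le> d \<Longrightarrow> e i = primitive_idempotent scaleA h X (t i)"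
  shows "simple_spectrum scaleA d h X e t"
proof -
  let ?S = "alg_eigenvalues h X" and ?n = "Suc d"
  have card: "card ?S = Suc d" using mf by (simp add: multiplicity_free_def)
  then have fin: "finite ?S" by (metis card_ge_0_finite zero_less_Suc)
  have "inj_on e {..d}"
    using ord by (simp add: primitive_idempotents_ordering_def bij_betw_def atLeast0AtMost)
  then have inj: "inj_on t {..d}"
    by (auto simp: inj_on_def e)
  have img: "t ` {..d} = ?S"
    by (rule card_subset_eq[OF fin]) (auto simp: t card card_image[OF inj])
  have "\<exists>v. \<forall>j\<le>d. eigenvector (h X) (v j) (t j)"
    using t by (auto simp: alg_eigenvalues_def eigenvalue_def intro: choice)
  then obtain v where "\<And>j. j \<le> d \<Longrightarrow> eigenvector (h X) (v j) (t j)" by blast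
  then have v: "v j \<in> carrier_vec ?n" "v j \<noteq> 0\<^sub>v ?n" "h X *\<^sub>v v j = t j \<cdot>\<^sub>v v j" if "j \<le> d" for j
    using that by (auto simp: eigenvector_def)
  have ev_v: "h (ev p X) *\<^sub>v v j = poly p (t j) \<cdot>\<^sub>v v j" if "j \<le> d" for p j
    using v that by (intro h_ev_eigenvector)
  have X_v: "h X *\<^sub>v v j = t j \<cdot>\<^sub>v v j" if "j \<le> d" for j
    using v that by blast
  have zero_v: "0 \<cdot>\<^sub>v v j = 0\<^sub>v ?n" if "j \<le> d" for j
    using v(1)[OF that] by (intro eq_vecI) auto
  have e_v: "h (e i) *\<^sub>v v j = (if i = j then 1 else 0) \<cdot>\<^sub>v v j" if ij: "i \<le> d" "j \<le> d" for i j
  proof -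
    have factor: "poly (Polynomial.smult (1 / (a - s)) [:- s, 1:]) b = (b - s) / (a - s)" for a b s :: 'k
      by (simp add: diff_divide_distrib)
    have "poly (\<Prod>s\<in>?S - {t i}. Polynomial.smult (1 / (t i - s)) [:- s, 1:]) (t j)
        = (if i = j then 1 else 0)"
    proof (cases "i = j")
      case True
      then show ?thesis unfolding poly_prod factor by (auto intro!: prod.neutral split: if_splits)
    next
      case False
      then have "t j \<in> ?S - {t i}"
        using ij inj t by (auto simp: inj_on_def)
      then show ?thesis unfolding poly_prod factor using False fin by (auto intro!: prod_zero)
    qed
    then show ?thesis
      using ij by (simp only: e primitive_idempotent_def ev_v)
  qed
  define P where "P = mat ?n ?n (\<lambda>(k, j). v j $ k)"
  have P: "P \<in> carrier_mat ?n ?n" by (simp add: P_def)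
  have colP: "col P j = v j" if "j \<le> d" for j
    using that v(1)[OF that] by (intro eq_vecI) (auto simp: P_def)
  have eP: "h (e i) * P = mat ?n ?n (\<lambda>(k, j). if i = j then v i $ k else 0)" if "i \<le> d" for i
  proof (rule mat_col_eqI)
    fix j assume "j < dim_col (mat ?n ?n (\<lambda>(k, j). if i = j then v i $ k else 0))"
    then have j: "j \<le> d" by simp
    then have "col (h (e i) * P) j = h (e i) *\<^sub>v v j"
      by (subst col_mult2[OF h_carrier P]) (simp_all add: colP)
    also have "\<dots> = col (mat ?n ?n (\<lambda>(k, j). if i = j then v i $ k else 0)) j"
      using v(1)[OF j] j by (subst e_v[OF that j], intro eq_vecI) auto
    finally show "col (h (e i) * P) j = col (mat ?n ?n (\<lambda>(k, j). if i = j then v i $ k else 0)) j" .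
  qed (use P in auto)
  \<comment> \<open>If \<open>P c = 0\<close>, applying \<open>e\<^sub>i\<close> isolates \<open>c\<^sub>i v\<^sub>i = 0\<close>.\<close>
  have "det P \<noteq> 0"
  proof
    assume "det P = 0"
    then obtain c where c: "c \<in> carrier_vec ?n" "c \<noteq> 0\<^sub>v ?n" "P *\<^sub>v c = 0\<^sub>v ?n"
      using det_0_iff_vec_prod_zero_field[OF P] by blast
    have "c $ i = 0" if i: "i \<le> d" for i
    proof -
      obtain k where k: "k \<le> d" "v i $ k \<noteq> 0"
        using v(1,2)[OF i] by (metis carrier_vecD eq_vecI index_zero_vec less_Suc_eq_le)
      have "(h (e i) * P) *\<^sub>v c = 0\<^sub>v ?n"
        using c by (simp add: assoc_mult_mat_vec[OF h_carrier P] ) (intro eq_vecI; simp)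
      moreover have "((h (e i) * P) *\<^sub>v c) $ k = v i $ k * c $ i"
        using c i k by (simp add: eP scalar_prod_def if_distrib[of "\<lambda>x. x * _"] cong: if_cong)
      ultimately show ?thesis using k by simp
    qed
    then show False using c by (metis carrier_vecD eq_vecI index_zero_vec less_Suc_eq_le)
  qed
  then have "P \<in> Units (ring_mat TYPE('k) ?n ())"
    by (rule det_non_zero_imp_unit[OF P])
  then obtain R where R: "R \<in> carrier_mat ?n ?n" "P * R = 1\<^sub>m ?n"
    by (auto simp: Units_def ring_mat_def)
  have recover: "h x = (h x * P) * R" for x
    by (simp add: assoc_mult_mat[OF h_carrier P R(1)] R(2) right_mult_one_mat[OF h_carrier])
  have eqI: "x = y" if "\<And>j. j \<le> d \<Longrightarrow> h x *\<^sub>v v j = h y *\<^sub>v v j" for x y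
  proof -
    have "h x * P = h y * P"
    proof (rule mat_col_eqI)
      fix j assume "j < dim_col (h y * P)"
      then have "j \<le> d" using P by simp
      then show "col (h x * P) j = col (h y * P) j"
        using that by (simp add: col_mult2[OF h_carrier P] colP)
    qed (use P in auto)
    then have "h x = h y" by (metis recover)
    then show ?thesis using iso_bij by (auto simp: bij_betw_def inj_on_def)
  qed
  show ?thesis
  proof unfold_locales
    show "inj_on t {..d}" by (rule inj)
    show "X * e i = scaleA (t i) (e i)" if "i \<le> d" for i
      using that by (intro eqI) (auto simp: h_vec v(1) e_v X_v mult_mat_vec[OF h_carrier] smult_smult_assoc)
    show "e i * e j = (if i = j then e i else 0)" if "i \<le> d" "j \<le> d" for i j
      using that by (intro eqI) (auto simp: h_vec v(1) e_v zero_v mult_mat_vec[OF h_carrier] smult_smult_assoc)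
    show "(\<Sum>i\<le>d. e i) = 1"
    proof (rule eqI)
      fix j assume j: "j \<le> d"
      have "h (\<Sum>i\<le>m. e i) *\<^sub>v v j = (if j \<le> m then 1 else 0) \<cdot>\<^sub>v v j" if "m \<le> d" for m
        using that
      proof (induction m)
        case 0
        then show ?case using e_v[of 0 j] j by simp
      next
        case (Suc m)
        then show ?case using j
          by (auto simp: h_vec(3) v(1) e_v zero_v smult_carrier_vec simp flip: add_smult_distrib_vec)
      qed
      from this[of d] show "h (\<Sum>i\<le>d. e i) *\<^sub>v v j = h 1 *\<^sub>v v j"
        using j by (simp add: h_vec v(1))
    qed
    show "e i \<noteq> 0" if i: "i \<le> d" for i
      using e_v[OF i i] v(1,2)[OF i] by (auto simp: h_vec)
    show "rank_one (e i)" if i: "i \<le> d" for i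
      unfolding rank_one_def
    proof (intro exI allI impI)
      fix k l assume kl: "k \<le> d" "l \<le> d"
      have "h (e i) $$ (k, l) = ((h (e i) * P) * R) $$ (k, l)" by (simp flip: recover)
      also have "\<dots> = v i $ k * R $$ (i, l)"
        using kl i R by (simp add: eP scalar_prod_def if_distrib[of "\<lambda>x. x * _"] cong: if_cong)
      finally show "h (e i) $$ (k, l) = v i $ k * R $$ (i, l)" .
    qed
  qed
qed

section \<open>Tridiagonal action\<close>

locale tridiagonal = simple_spectrum scaleA d h X e t
  for scaleA :: "'k::field \<Rightarrow> 'a::ring_1 \<Rightarrow> 'a" and d h X e t +
  fixes Y :: 'a
  assumes tri_zero: "\<lbrakk>i \<le> d; j \<le> d; \<bar>int i - int j\<bar> > 1\<rbrakk> \<Longrightarrow> e i * Y * e j = 0"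
    and tri_nonzero: "\<lbrakk>i \<le> d; j \<le> d; \<bar>int i - int j\<bar> = 1\<rbrakk> \<Longrightarrow> e i * Y * e j \<noteq> 0"
begin

text \<open>
  Each factor \<open>Y\<close> moves the index by at most one.
\<close>

lemma power_band:
  assumes "i \<le> d" "j \<le> d" "\<bar>int i - int j\<bar> > int n"
  shows "e i * Y ^ n * e j = 0"
  using assms
proof (induction n arbitrary: j)
  case 0
  then show ?case by (auto simp: e_e)
next
  case (Suc n)
  have "e i * Y ^ n * e m * (Y * e j) = 0" if "m \<le> d" for m
  proof (cases "\<bar>int i - int m\<bar> > int n")
    case True
    then show ?thesis using Suc.IH[of m] Suc.prems that by simp
  next
    case False
    then have "e m * Y * e j = 0" using tri_zero[of m j] Suc.prems that by simp
    then show ?thesis by (simp add: mult.assoc)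
  qed
  then show ?case
    using insert_sum[of "e i * Y ^ n" "Y * e j"]
    by (simp add: power_Suc2 mult.assoc del: power_Suc)
qed

lemma ev_band:
  assumes "i \<le> d" "j \<le> d" "\<bar>int i - int j\<bar> > int (degree p)"
  shows "e i * ev p Y * e j = 0"
  using assms power_band[of i j]
  by (simp add: poly_alg_def sum_distrib_left sum_distrib_right)

text \<open>
  Along a path of exactly \<open>|i - j|\<close> steps there is only one way from \<open>i\<close> to \<open>j\<close>, and each of its steps is
  nonzero, so cancellation at the intermediate idempotents applies.
\<close>

lemma power_edge:
  assumes "i \<le> d" "j \<le> d" "\<bar>int i - int j\<bar> = int n"
  shows "e i * Y ^ n * e j \<noteq> 0"
  using assms
proof (induction n arbitrary: j)
  case 0
  then show ?case by (simp add: e_e e_nonzero)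
next
  case (Suc n)
  \<comment> \<open>The neighbour of \<open>j\<close> on the way to \<open>i\<close>.\<close>
  define l where "l = (if i < j then j - 1 else Suc j)"
  have l: "l \<le> d" "\<bar>int i - int l\<bar> = int n" "\<bar>int l - int j\<bar> = 1"
    using Suc.prems by (auto simp: l_def split: if_splits)
  have "e i * Y ^ n * (Y * e j) = e i * Y ^ n * e l * (Y * e j)"
  proof (rule insert_one[OF l(1)])
    fix m assume m: "m \<le> d" "m \<noteq> l"
    have "\<bar>int i - int m\<bar> > int n \<or> \<bar>int m - int j\<bar> > 1"
      using m Suc.prems unfolding l_def by (auto split: if_splits)
    then show "e i * Y ^ n * e m = 0 \<or> e m * (Y * e j) = 0"
      using power_band[of i m n] tri_zero[of m j] Suc.prems m by (auto simp: mult.assoc)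
  qed
  moreover have "e i * Y ^ n * e l * (Y * e j) \<noteq> 0"
    using cancel[OF l(1) Suc.IH] tri_nonzero[OF l(1) _ l(3)] Suc.prems l by (simp add: mult.assoc)
  ultimately show ?case
    by (simp add: power_Suc2 mult.assoc del: power_Suc)
qed

text \<open>
  At distance equal to the degree only the leading term contributes. So one monic polynomial may be
  exchanged for another of the same degree with more convenient roots.
\<close>

lemma ev_monic_edge:
  assumes "i \<le> d" "j \<le> d" "\<bar>int i - int j\<bar> = int (degree p)" "monic p"
  shows "e i * ev p Y * e j = e i * Y ^ degree p * e j"
proof (cases "degree p")
  case 0
  with assms(4) have "p = 1" using monic_degree_0 by blast
  then show ?thesis by simp
next
  case (Suc n)
  have "ev p Y = (\<Sum>k\<le>n. scaleA (coeff p k) (Y ^ k)) + Y ^ degree p"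
    using assms(4) Suc by (simp add: poly_alg_def)
  moreover have "e i * (\<Sum>k\<le>n. scaleA (coeff p k) (Y ^ k)) * e j = 0"
    using assms power_band[of i j] Suc by (simp add: sum_distrib_left sum_distrib_right)
  ultimately show ?thesis by (simp add: distrib_left distrib_right)
qed

lemma reverse: "tridiagonal scaleA d h X (\<lambda>i. e (d - i)) (\<lambda>i. t (d - i)) Y"
proof -
  interpret r: simple_spectrum scaleA d h X "\<lambda>i. e (d - i)" "\<lambda>i. t (d - i)" by (rule reverse)
  show ?thesis
  proof unfold_locales
    fix i j assume ij: "i \<le> d" "j \<le> d"
    then have "int (d - i) - int (d - j) = int j - int i" by simp
    then show "\<bar>int i - int j\<bar> > 1 \<Longrightarrow> e (d - i) * Y * e (d - j) = 0"
      and "\<bar>int i - int j\<bar> = 1 \<Longrightarrow> e (d - i) * Y * e (d - j) \<noteq> 0"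
      using tri_zero[of "d - i" "d - j"] tri_nonzero[of "d - i" "d - j"] by simp_all
  qed
qed

end

lemma eta_reverse: "i \<le> d \<Longrightarrow> eta d (\<lambda>i. t (d - i)) i = tau t i"
  unfolding eta_def tau_def by (rule prod.cong) auto

lemma poly_tau: "poly (tau t i) x = (\<Prod>j<i. x - t j)"
  by (simp add: tau_def poly_prod)

lemma poly_eta: "poly (eta d t i) x = (\<Prod>j<i. x - t (d - j))"
  by (simp add: eta_def poly_prod)

lemma monic_linear_prod:
  fixes g :: "'b \<Rightarrow> 'k::field"
  shows "monic (\<Prod>j\<in>J. [:- g j, 1:])"
  by (rule monic_prod) simp

lemma degree_linear_prod:
  fixes g :: "'b \<Rightarrow> 'k::field"
  shows "finite J \<Longrightarrow> degree (\<Prod>j\<in>J. [:- g j, 1:]) = card J"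
  by (subst degree_prod_eq_sum_degree) auto

lemma monic_tau: "monic (tau t i)"
  unfolding tau_def by (rule monic_linear_prod)

lemma degree_tau [simp]: "degree (tau t i) = i"
  by (simp add: tau_def degree_linear_prod)

lemma monic_eta: "monic (eta d t i)"
  unfolding eta_def by (rule monic_linear_prod)

lemma degree_eta [simp]: "degree (eta d t i) = i"
  by (simp add: eta_def degree_linear_prod)

lemma poly_tau_eq_0: "m < i \<Longrightarrow> poly (tau t i) (t m) = 0"
  unfolding poly_tau by (intro prod_zero bexI[of _ m]) auto

lemma poly_eta_eq_0: "m \<le> d \<Longrightarrow> d < m + i \<Longrightarrow> poly (eta d t i) (t m) = 0"
  unfolding poly_eta by (intro prod_zero bexI[of _ "d - m"]) auto

lemma poly_tau_nonzero:
  assumes "inj_on t {..d}" "i \<le> m" "m \<le> d"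
  shows "poly (tau t i) (t m) \<noteq> 0"
  unfolding poly_tau using inj_onD[OF assms(1), of m] assms(2,3) by fastforce

lemma poly_eta_nonzero:
  assumes "inj_on t {..d}" "m + i \<le> d"
  shows "poly (eta d t i) (t m) \<noteq> 0"
  unfolding poly_eta using inj_onD[OF assms(1), of m] assms(2) by fastforce

section \<open>Leonard systems\<close>

text \<open>
  The relations of a Leonard system in a form that is symmetric under exchanging \<open>A\<close> with \<open>A\<^sup>*\<close>
  (\<open>swap\<close>) and under reversing the order of the \<open>E\<^sub>i\<close> (\<open>reverse\<close>). Through these two symmetries each
  argument is needed in one orientation only; reversal turns \<open>\<eta>\<close> into \<open>\<tau>\<close>.
\<close>

locale leonard = full_matrix_algebra scaleA d h +
  P: tridiagonal scaleA d h A E \<theta> As + S: tridiagonal scaleA d h As Es \<theta>s A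
  for scaleA :: "'k::field \<Rightarrow> 'a::ring_1 \<Rightarrow> 'a" and d h A E \<theta> As Es \<theta>s
begin

lemma swap: "leonard scaleA d h As Es \<theta>s A E \<theta>"
  by unfold_locales

lemma reverse: "leonard scaleA d h A (\<lambda>i. E (d - i)) (\<lambda>i. \<theta> (d - i)) As Es \<theta>s"
  by (intro leonard.intro full_matrix_algebra_axioms P.reverse S.tridiagonal_axioms)

text \<open>
  If \<open>E\<^sup>*\<^sub>i E\<^sub>d = 0\<close>, then also \<open>E\<^sup>*\<^sub>i (A\<^sup>*)\<^sup>k E\<^sub>d = 0\<close>, as \<open>A\<^sup>*\<close> acts on \<open>E\<^sup>*\<^sub>i\<close> by a scalar. Since \<open>(A\<^sup>*)\<^sup>k E\<^sub>d\<close>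
  reaches down to \<open>E\<^bsub>d-k\<^esub>\<close> and no further, \<open>E\<^sup>*\<^sub>i E\<^bsub>d-k\<^esub> = 0\<close> follows for one \<open>k\<close> after the other,
  and summing over \<open>k\<close> gives \<open>E\<^sup>*\<^sub>i = 0\<close>.
  For an interior index in place of \<open>d\<close> the powers of \<open>A\<^sup>*\<close> would spread to both sides and the argument
  would break down.
\<close>

lemma Es_Ed_nonzero:
  assumes i: "i \<le> d"
  shows "Es i * E d \<noteq> 0"
proof
  assume 0: "Es i * E d = 0"
  have "Es i * E (d - k) = 0" if "k \<le> d" for k
    using that
  proof (induction k rule: less_induct)
    case (less k)
    have "Es i * (As ^ k * E d) = Es i * E (d - k) * (As ^ k * E d)"
    proof (rule P.insert_one)
      fix m assume m: "m \<le> d" "m \<noteq> d - k"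
      show "Es i * E m = 0 \<or> E m * (As ^ k * E d) = 0"
      proof (cases "m < d - k")
        case True
        then show ?thesis using P.power_band[of m d k] by (auto simp: mult.assoc)
      next
        case False
        then show ?thesis using less.IH[of "d - m"] less.prems m by auto
      qed
    qed simp
    moreover have "Es i * As ^ k = scaleA (\<theta>s i ^ k) (Es i)"
      by (induction k) (simp_all add: mult.assoc[symmetric] S.e_X i mult.commute)
    ultimately have "Es i * E (d - k) * (As ^ k * E d) = 0"
      using 0 by (simp add: mult.assoc[symmetric])
    moreover have "E (d - k) * (As ^ k * E d) \<noteq> 0"
      using P.power_edge[of "d - k" d k] less.prems by (simp add: mult.assoc)
    ultimately show ?case using P.cancel[of "d - k" "Es i" "As ^ k * E d"] by auto
  qed
  then have "Es i * E j = 0" if "j \<le> d" for j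
    using that by (metis diff_diff_cancel diff_le_self)
  then have "Es i * 1 = 0"
    using P.insert_sum[of "Es i" 1] by simp
  then show False using S.e_nonzero[OF i] by simp
qed

lemma Es_E0_nonzero: "i \<le> d \<Longrightarrow> Es i * E 0 \<noteq> 0"
  using leonard.Es_Ed_nonzero[OF reverse] by simp

lemma E_Es0_nonzero: "i \<le> d \<Longrightarrow> E i * Es 0 \<noteq> 0"
  by (rule leonard.Es_E0_nonzero[OF swap])

lemma E_Esd_nonzero: "i \<le> d \<Longrightarrow> E i * Es d \<noteq> 0"
  by (rule leonard.Es_Ed_nonzero[OF swap])

text \<open>
  This is \<open>phi\<^sub>1 \<dots> phi\<^sub>i\<close> (see \<open>prod_split\<close>), written without the division by traces whose nonvanishing is
  still to be shown.
\<close>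

definition split_prod :: "nat \<Rightarrow> 'k" where
  "split_prod i = (\<Prod>k=1..i. \<theta>s 0 - \<theta>s k) * tr (ev (eta d \<theta> i) A * Es 0)"

text \<open>
  The range of \<open>p(A\<^sup>*) E\<^sub>d\<close> lies in the last \<open>degree p + 1\<close> eigenspaces of \<open>A\<close>, and \<open>\<eta>\<^sub>r(A)\<close> kills the last \<open>r\<close>.
\<close>

lemma eta_ev_As_Ed:
  assumes "r \<le> d" "degree p < r"
  shows "ev (eta d \<theta> r) A * ev p As * E d = 0"
proof -
  have "ev (eta d \<theta> r) A * E m * (ev p As * E d) = 0" if "m \<le> d" for m
  proof (cases "d < m + r")
    case True
    then show ?thesis using poly_eta_eq_0[of m d r \<theta>] that by (simp add: P.ev_e)
  next
    case False
    then have "E m * ev p As * E d = 0"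
      using assms that by (intro P.ev_band) auto
    then show ?thesis by (simp add: mult.assoc)
  qed
  then show ?thesis using P.insert_sum[of "ev (eta d \<theta> r) A" "ev p As * E d"] by (simp add: mult.assoc)
qed

text \<open>
  By the previous lemma the left side depends on \<open>p\<close> only through its leading term. The roots
  \<open>\<theta>\<^sup>*\<^sub>1, \<dots>, \<theta>\<^sup>*\<^sub>r\<close> are chosen to annihilate every component \<open>E\<^sup>*\<^sub>m\<close> that \<open>E\<^sup>*\<^sub>0 \<eta>\<^sub>r(A)\<close> can reach except
  \<open>m = 0\<close>, where the compression \<open>E\<^sup>*\<^sub>0 \<eta>\<^sub>r(A) E\<^sup>*\<^sub>0\<close> produces the trace.
\<close>

lemma split_top:
  assumes "r \<le> d" "monic p" "degree p = r"
  shows "Es 0 * ev (eta d \<theta> r) A * ev p As * E d = scaleA (split_prod r) (Es 0 * E d)"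
proof -
  define q where "q = (\<Prod>k\<in>{1..r}. [:- \<theta>s k, 1:])"
  have q: "monic q" "degree q = r"
    unfolding q_def by (rule monic_linear_prod, simp add: degree_linear_prod)
  have "Es 0 * ev (eta d \<theta> r) A * ev p As * E d = Es 0 * ev (eta d \<theta> r) A * ev q As * E d"
  proof (cases "p = q")
    case False
    have "degree (p - q) < r"
    proof (rule degree_lessI)
      show "p - q \<noteq> 0 \<or> 0 < r" using False by simp
      show "\<forall>k\<ge>r. coeff (p - q) k = 0"
        using q assms by (auto simp: coeff_eq_0 le_less)
    qed
    then have "ev (eta d \<theta> r) A * ev (p - q) As * E d = 0"
      by (rule eta_ev_As_Ed[OF assms(1)])
    then show ?thesis by (simp add: ev_diff algebra_simps)
  qed simp
  also have "\<dots> = Es 0 * ev (eta d \<theta> r) A * Es 0 * (ev q As * E d)"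
    unfolding mult.assoc[of _ "ev q As"]
  proof (rule S.insert_one)
    fix m assume m: "m \<le> d" "m \<noteq> 0"
    show "Es 0 * ev (eta d \<theta> r) A * Es m = 0 \<or> Es m * (ev q As * E d) = 0"
    proof (cases "m \<le> r")
      case True
      have "poly q (\<theta>s m) = 0"
        unfolding q_def poly_prod using True m by (intro prod_zero bexI[of _ m]) auto
      then show ?thesis using m by (simp add: mult.assoc[symmetric] S.e_ev)
    next
      case False
      then show ?thesis using m S.ev_band[of 0 m "eta d \<theta> r"] by simp
    qed
  qed simp
  also have "\<dots> = scaleA (tr (ev (eta d \<theta> r) A * Es 0)) (Es 0 * ev q As * E d)"
    by (simp add: S.compress flip: mult.assoc)
  also have "\<dots> = scaleA (split_prod r) (Es 0 * E d)"
    by (simp add: S.e_ev split_prod_def q_def poly_prod mult.commute)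
  finally show ?thesis .
qed

text \<open>
  For \<open>i < r\<close> the product vanishes from the right, by the eigenspaces of \<open>A\<close>. For \<open>i > r\<close> it vanishes from
  the left: \<open>E\<^sup>*\<^sub>0 \<eta>\<^sub>r(A)\<close> reaches only the \<open>E\<^sup>*\<^sub>m\<close> with \<open>m \<le> r\<close>, all of which \<open>\<tau>\<^sup>*\<^sub>i(A\<^sup>*)\<close> kills.
\<close>

lemma Es0_eta_tau_Ed:
  assumes "r \<le> d" "i \<le> d"
  shows "Es 0 * ev (eta d \<theta> r) A * ev (tau \<theta>s i) As * E d
    = (if r = i then scaleA (split_prod r) (Es 0 * E d) else 0)"
proof (cases i r rule: linorder_cases)
  case equal
  then show ?thesis using split_top[of r "tau \<theta>s i"] assms monic_tau[of \<theta>s i] by simp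
next
  case less
  then show ?thesis using eta_ev_As_Ed[of r "tau \<theta>s i"] assms by (simp add: mult.assoc)
next
  case greater
  have "Es 0 * ev (eta d \<theta> r) A * Es m * ev (tau \<theta>s i) As = 0" if m: "m \<le> d" for m
  proof (cases "m \<le> r")
    case True
    then show ?thesis using m greater poly_tau_eq_0[of m i \<theta>s] by (simp add: mult.assoc S.e_ev)
  next
    case False
    then show ?thesis using m S.ev_band[of 0 m "eta d \<theta> r"] by simp
  qed
  then have "Es 0 * ev (eta d \<theta> r) A * ev (tau \<theta>s i) As = 0"
    using S.insert_sum[of "Es 0 * ev (eta d \<theta> r) A" "ev (tau \<theta>s i) As"] by simp
  then show ?thesis using greater by simp
qed

text \<open>
  The same product \<open>E\<^sup>*\<^sub>0 \<eta>\<^sub>i(A) \<tau>\<^sup>*\<^sub>i(A\<^sup>*) E\<^sub>d\<close>, this time with \<open>\<tau>\<^sup>*\<^sub>i\<close> left in place: its roots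
  \<open>\<theta>\<^sup>*\<^sub>0, \<dots>, \<theta>\<^sup>*\<^bsub>i-1\<^esub>\<close> single out the component \<open>E\<^sup>*\<^sub>i\<close> instead, and there both factors are nonzero.
\<close>

lemma split_prod_nonzero:
  assumes "i \<le> d"
  shows "split_prod i \<noteq> 0"
proof
  assume "split_prod i = 0"
  then have "0 = Es 0 * ev (eta d \<theta> i) A * (ev (tau \<theta>s i) As * E d)"
    using Es0_eta_tau_Ed[OF assms assms] by (simp add: mult.assoc)
  also have "\<dots> = Es 0 * ev (eta d \<theta> i) A * Es i * (ev (tau \<theta>s i) As * E d)"
  proof (rule S.insert_one[OF assms])
    fix m assume m: "m \<le> d" "m \<noteq> i"
    show "Es 0 * ev (eta d \<theta> i) A * Es m = 0 \<or> Es m * (ev (tau \<theta>s i) As * E d) = 0"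
    proof (cases "m < i")
      case True
      then show ?thesis using m poly_tau_eq_0[of m i \<theta>s] by (simp add: mult.assoc[symmetric] S.e_ev)
    next
      case False
      then show ?thesis using m S.ev_band[of 0 m "eta d \<theta> i"] by simp
    qed
  qed
  finally have 0: "Es 0 * ev (eta d \<theta> i) A * Es i * (ev (tau \<theta>s i) As * E d) = 0" by simp
  have "Es 0 * ev (eta d \<theta> i) A * Es i \<noteq> 0"
    using S.ev_monic_edge[of 0 i "eta d \<theta> i"] S.power_edge[of 0 i i] assms monic_eta[of d \<theta> i] by simp
  moreover have "poly (tau \<theta>s i) (\<theta>s i) \<noteq> 0"
    using poly_tau_nonzero[OF S.inj_t] assms by simp
  then have "Es i * (ev (tau \<theta>s i) As * E d) \<noteq> 0"
    using assms Es_Ed_nonzero[OF assms] by (simp add: mult.assoc[symmetric] S.e_ev)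
  ultimately show False using S.cancel[OF assms] 0 by blast
qed

lemma tr_eta_nonzero: "i \<le> d \<Longrightarrow> tr (ev (eta d \<theta> i) A * Es 0) \<noteq> 0"
  using split_prod_nonzero by (auto simp: split_prod_def)

text \<open>
  The quotients of traces telescope, starting from \<open>tr(E\<^sup>*\<^sub>0) = 1\<close>.
\<close>

lemma prod_split:
  assumes "i \<le> d"
    and "\<And>k. 1 \<le> k \<Longrightarrow> k \<le> d \<Longrightarrow> f k = (\<theta>s 0 - \<theta>s k) *
        (tr (ev (eta d \<theta> k) A * Es 0) / tr (ev (eta d \<theta> (k - 1)) A * Es 0))"
  shows "(\<Prod>k=1..i. f k) = split_prod i"
  using assms(1)
proof (induction i)
  case 0
  then show ?case by (simp add: split_prod_def S.tr_e eta_def)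
next
  case (Suc i)
  then show ?case
    using tr_eta_nonzero[of i] by (simp add: assms(2) split_prod_def)
qed

text \<open>
  The polynomial \<open>\<eta>\<^sup>*\<^bsub>d-r\<^esub> \<tau>\<^sup>*\<^sub>i\<close> has degree \<open>d - r + i\<close>. For \<open>r < i\<close> its roots exhaust the spectrum of \<open>A\<^sup>*\<close>.
  For \<open>r > i\<close> its degree is too small to connect \<open>E\<^sub>d\<close> to \<open>E\<^sub>0\<close>, and for \<open>r = i\<close> only its leading term does.
\<close>

lemma E0_eta_tau_Ed:
  assumes "r \<le> d" "i \<le> d"
  shows "E 0 * ev (eta d \<theta>s (d - r)) As * ev (tau \<theta>s i) As * E d
    = (if r = i then E 0 * As ^ d * E d else 0)"
proof -
  let ?p = "eta d \<theta>s (d - r) * tau \<theta>s i"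
  have monic: "monic ?p" by (rule monic_mult[OF monic_eta monic_tau])
  have "degree ?p = degree (eta d \<theta>s (d - r)) + degree (tau \<theta>s i)"
    by (rule degree_mult_eq) (use monic_eta[of d \<theta>s "d - r"] monic_tau[of \<theta>s i] in force)+
  then have deg: "degree ?p = d - r + i" by simp
  have "E 0 * ev ?p As * E d = (if r = i then E 0 * As ^ d * E d else 0)"
  proof (cases r i rule: linorder_cases)
    case less
    have "poly ?p (\<theta>s m) = 0" if "m \<le> d" for m
      using that less assms poly_tau_eq_0[of m i \<theta>s] poly_eta_eq_0[of m d "d - r" \<theta>s]
      by (cases "m < i") auto
    then show ?thesis using less by (simp add: S.ev_vanish)
  next
    case equal
    then show ?thesis using P.ev_monic_edge[of 0 d ?p] deg monic assms by simp
  next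
    case greater
    then show ?thesis using P.ev_band[of 0 d ?p] deg assms by simp
  qed
  then show ?thesis by (simp add: ev_mult mult.assoc)
qed

lemma eta_d_A: "ev (eta d \<theta> d) A = scaleA (poly (eta d \<theta> d) (\<theta> 0)) (E 0)"
  by (rule P.ev_single) (auto intro: poly_eta_eq_0)

lemma tau_d_A: "ev (tau \<theta> d) A = scaleA (poly (tau \<theta> d) (\<theta> d)) (E d)"
  by (rule P.ev_single) (auto intro: poly_tau_eq_0)

text \<open>
  Between \<open>E\<^sup>*\<^sub>0\<close> and \<open>E\<^sup>*\<^sub>d\<close>, in either order, \<open>A\<^sup>d\<close> may be replaced by any monic polynomial of degree \<open>d\<close>. The choices
  \<open>\<eta>\<^sub>d\<close> and \<open>\<tau>\<^sub>d\<close> make it a multiple of \<open>E\<^sub>0\<close> and of \<open>E\<^sub>d\<close>; comparing the two relates products of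
  idempotents at different corners.
\<close>

lemma power_eq_eta: "Es i * A ^ d * Es j = scaleA (poly (eta d \<theta> d) (\<theta> 0)) (Es i * E 0 * Es j)"
  if "{i, j} = {0, d}"
  using that S.ev_monic_edge[of i j "eta d \<theta> d"] monic_eta[of d \<theta> d]
  by (auto simp: eta_d_A doubleton_eq_iff)

lemma power_eq_tau: "Es i * A ^ d * Es j = scaleA (poly (tau \<theta> d) (\<theta> d)) (Es i * E d * Es j)"
  if "{i, j} = {0, d}"
  using that S.ev_monic_edge[of i j "tau \<theta> d"] monic_tau[of \<theta> d]
  by (auto simp: tau_d_A doubleton_eq_iff)

lemma Es0_E0_power_Ed:
  "scaleA (poly (eta d \<theta> d) (\<theta> 0)) (Es 0 * (E 0 * As ^ d * E d)) = scaleA (split_prod d) (Es 0 * E d)"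
proof -
  have "Es 0 * ev (eta d \<theta> d) A * ev (tau \<theta>s d) As * E d = scaleA (split_prod d) (Es 0 * E d)"
    by (rule split_top) (use monic_tau[of \<theta>s d] in simp_all)
  moreover have "E 0 * ev (tau \<theta>s d) As * E d = E 0 * As ^ d * E d"
    using P.ev_monic_edge[of 0 d "tau \<theta>s d"] monic_tau[of \<theta>s d] by simp
  ultimately show ?thesis by (simp add: eta_d_A mult.assoc)
qed

text \<open>
  Both sides are the coefficient of \<open>E\<^sub>0 E\<^sup>*\<^sub>0\<close> in one element: starting from \<open>E\<^sub>0 E\<^sup>*\<^sub>0 E\<^sub>d E\<^sup>*\<^sub>0\<close>, the dual of
  the comparison just made moves \<open>E\<^sup>*\<^sub>0\<close> to \<open>E\<^sup>*\<^sub>d\<close> in the second place, and the comparison itself moves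
  \<open>E\<^sub>d\<close> to \<open>E\<^sub>0\<close> in the third.
\<close>

lemma corner_traces:
  "poly (eta d \<theta>s d) (\<theta>s 0) * poly (tau \<theta> d) (\<theta> d) * tr (E d * Es 0)
   = poly (tau \<theta>s d) (\<theta>s d) * poly (eta d \<theta> d) (\<theta> 0) * tr (Es d * E 0)"
  (is "?etas * ?tau * _ = ?taus * ?eta * _")
proof -
  interpret s: leonard scaleA d h As Es \<theta>s A E \<theta> by (rule swap)
  have a: "scaleA ?etas (E 0 * Es 0 * E d) = scaleA ?taus (E 0 * Es d * E d)"
    using s.power_eq_eta[of 0 d] s.power_eq_tau[of 0 d] by simp
  have b: "scaleA ?tau (Es d * E d * Es 0) = scaleA ?eta (Es d * E 0 * Es 0)"
    using power_eq_eta[of d 0] power_eq_tau[of d 0] by (simp add: insert_commute)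
  have "scaleA (?etas * ?tau * tr (E d * Es 0)) (E 0 * Es 0)
      = scaleA ?tau (scaleA ?etas (E 0 * (Es 0 * E d * Es 0)))"
    by (simp add: S.compress)
  also have "\<dots> = scaleA ?tau (scaleA ?etas (E 0 * Es 0 * E d) * Es 0)"
    by (simp add: mult.assoc)
  also have "\<dots> = scaleA ?taus (E 0 * scaleA ?tau (Es d * E d * Es 0))"
    unfolding a by (simp add: mult.assoc mult.commute)
  also have "\<dots> = scaleA ?taus (scaleA ?eta (E 0 * Es d * E 0 * Es 0))"
    unfolding b by (simp add: mult.assoc)
  also have "\<dots> = scaleA (?taus * ?eta * tr (Es d * E 0)) (E 0 * Es 0)"
    by (simp add: P.compress)
  finally show ?thesis
    using E_Es0_nonzero[of 0] scale_right_imp_eq by blast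
qed

text \<open>
  In the system with reversed \<open>E\<^sub>i\<close> the first split sequence becomes the second. At the full length
  \<open>d\<close> the trace simplifies, because \<open>\<tau>\<^sub>d(A)\<close> is a multiple of \<open>E\<^sub>d\<close>.
\<close>

lemma prod_first_split:
  assumes "\<And>k. 1 \<le> k \<Longrightarrow> k \<le> d \<Longrightarrow> f k = (\<theta>s 0 - \<theta>s k) *
        (tr (ev (tau \<theta> k) A * Es 0) / tr (ev (tau \<theta> (k - 1)) A * Es 0))"
  shows "(\<Prod>k=1..d. f k) = poly (eta d \<theta>s d) (\<theta>s 0) * poly (tau \<theta> d) (\<theta> d) * tr (E d * Es 0)"
    and "(\<Prod>k=1..d. f k) \<noteq> 0"
proof -
  interpret r: leonard scaleA d h A "\<lambda>i. E (d - i)" "\<lambda>i. \<theta> (d - i)" As Es \<theta>s by (rule reverse)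
  have eq: "(\<Prod>k=1..d. f k) = r.split_prod d"
    by (rule r.prod_split) (auto simp: eta_reverse assms)
  then show "(\<Prod>k=1..d. f k) \<noteq> 0" using r.split_prod_nonzero by simp
  have "(\<Prod>k=1..d. \<theta>s 0 - \<theta>s k) = poly (eta d \<theta>s d) (\<theta>s 0)"
    unfolding poly_eta
    by (rule prod.reindex_bij_witness[where i = "\<lambda>k. d - k" and j = "\<lambda>k. d - k"]) auto
  then show "(\<Prod>k=1..d. f k) = poly (eta d \<theta>s d) (\<theta>s 0) * poly (tau \<theta> d) (\<theta> d) * tr (E d * Es 0)"
    unfolding eq r.split_prod_def by (simp add: eta_reverse tau_d_A tr_scale)
qed

text \<open>
  Replacing \<open>(A\<^sup>*)\<^sup>d\<close> by \<open>\<tau>\<^sup>*\<^sub>d(A\<^sup>*)\<close>, a multiple of \<open>E\<^sup>*\<^sub>d\<close>, creates the compression \<open>E\<^sup>*\<^sub>d E\<^sub>0 E\<^sup>*\<^sub>d\<close>.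
\<close>

lemma Esd_E0_power_Ed:
  assumes "\<And>k. 1 \<le> k \<Longrightarrow> k \<le> d \<Longrightarrow> f k = (\<theta>s 0 - \<theta>s k) *
        (tr (ev (tau \<theta> k) A * Es 0) / tr (ev (tau \<theta> (k - 1)) A * Es 0))"
  shows "scaleA (poly (eta d \<theta> d) (\<theta> 0)) (Es d * (E 0 * As ^ d * E d))
    = scaleA (\<Prod>k=1..d. f k) (Es d * E d)"
proof -
  interpret s: leonard scaleA d h As Es \<theta>s A E \<theta> by (rule swap)
  have "Es d * (E 0 * As ^ d * E d) = scaleA (poly (tau \<theta>s d) (\<theta>s d)) (Es d * E 0 * Es d * E d)"
    using s.power_eq_tau[of 0 d] by (simp add: mult.assoc)
  also have "\<dots> = scaleA (poly (tau \<theta>s d) (\<theta>s d) * tr (Es d * E 0)) (Es d * E d)"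
    by (simp add: S.compress tr_commute[of "E 0"])
  finally have "scaleA (poly (eta d \<theta> d) (\<theta> 0)) (Es d * (E 0 * As ^ d * E d))
    = scaleA (poly (tau \<theta>s d) (\<theta>s d) * poly (eta d \<theta> d) (\<theta> 0) * tr (Es d * E 0)) (Es d * E d)"
    by (simp add: mult_ac)
  then show ?thesis
    by (simp only: prod_first_split(1)[OF assms] corner_traces)
qed

end

section \<open>The module and its bilinear form\<close>

locale module_form =
  full_matrix_algebra scaleA d h + V: irreducible_left_module scaleV scaleA act
  for scaleA :: "'k::field \<Rightarrow> 'a::ring_1 \<Rightarrow> 'a" and d h
    and scaleV :: "'k \<Rightarrow> 'v::ab_group_add \<Rightarrow> 'v" and act +
  fixes dagger :: "'a \<Rightarrow> 'a" and B :: "'v \<Rightarrow> 'v \<Rightarrow> 'k"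
  assumes anti: "antiautomorphism scaleA dagger"
    and bilinear: "bilinear_form scaleV B"
    and B_nonzero: "\<exists>u v. B u v \<noteq> 0"
    and adjoint: "B (act x u) v = B u (act (dagger x) v)"
begin

lemma act_scaleV [simp]: "act x (scaleV c v) = scaleV c (act x v)"
proof -
  have "act x (act (scaleA c 1) v) = act (scaleA c x) v"
    by (simp flip: V.act_mult)
  then show ?thesis by (simp add: V.act_scale V.act_one)
qed

lemma act_zero_left [simp]: "act 0 v = 0"
  using V.act_add_left[of 0 0 v] by simp

lemma act_zero_right [simp]: "act x 0 = 0"
  using V.act_add_right[of x 0 0] by simp

lemma act_sum: "act (sum f I) v = (\<Sum>i\<in>I. act (f i) v)"
  by (induction I rule: infinite_finite_induct) (simp_all add: V.act_add_left)

lemma B_scale: "B (scaleV c u) v = c * B u v" "B u (scaleV c v) = c * B u v"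
  using bilinear unfolding bilinear_form_def
  by (metis module_hom.scale[OF module_hom_linearI])+

lemma B_add_right: "B u (v + w) = B u v + B u w"
  using bilinear unfolding bilinear_form_def
  by (metis module_hom.add[OF module_hom_linearI])

lemma cyclic:
  assumes "u \<noteq> 0"
  shows "\<exists>x. v = act x u"
proof -
  let ?W = "range (\<lambda>x. act x u)"
  have "?W = {0} \<or> ?W = UNIV"
  proof (rule V.irreducible)
    show "0 \<in> ?W" by (rule image_eqI[of _ _ 0]) auto
    show "w + w' \<in> ?W" if "w \<in> ?W" "w' \<in> ?W" for w w'
      using that by (auto simp flip: V.act_add_left)
    show "act x w \<in> ?W" if "w \<in> ?W" for x w
      using that by (auto simp flip: V.act_mult)
  qed
  moreover have "u \<in> ?W" by (rule image_eqI[of _ _ 1]) (auto simp: V.act_one)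
  ultimately show ?thesis using assms by blast
qed

text \<open>
  The adjoint relation makes the radical of the form a submodule, and the form is nonzero.
\<close>

lemma radical_zero:
  assumes "\<And>u. B u v = 0"
  shows "v = 0"
proof -
  let ?W = "{v. \<forall>u. B u v = 0}"
  have "?W = {0} \<or> ?W = UNIV"
  proof (rule V.irreducible)
    show "0 \<in> ?W" using B_scale(2)[of _ 0 0] by simp
    show "w + w' \<in> ?W" if "w \<in> ?W" "w' \<in> ?W" for w w'
      using that by (simp add: B_add_right)
    show "act x w \<in> ?W" if w: "w \<in> ?W" for x w
    proof -
      obtain y where "x = dagger y"
        using anti unfolding antiautomorphism_def by (meson bij_pointE)
      then show ?thesis using w by (simp flip: adjoint)
    qed
  qed
  then show ?thesis using B_nonzero assms by auto
qed

lemma dagger_ev: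
  assumes "dagger x = x"
  shows "dagger (ev p x) = ev p x"
proof -
  have lin: "Vector_Spaces.linear scaleA scaleA dagger" and mult: "dagger (y * z) = dagger z * dagger y" for y z
    using anti by (auto simp: antiautomorphism_def)
  obtain y where y: "1 = dagger y"
    using anti unfolding antiautomorphism_def by (meson bij_pointE)
  have one: "dagger 1 = 1"
    using mult[of y 1] y by simp
  have comm: "ev p x * x = x * ev p x" for p
    using ev_mult[of p "[:0, 1:]" x] ev_mult[of "[:0, 1:]" p x] by (simp add: mult.commute)
  show ?thesis
  proof (induction p)
    case 0
    show ?case using module_hom.scale[OF module_hom_linearI[OF lin], of 0 0] by simp
  next
    case (pCons a p)
    then show ?case
      by (simp add: module_hom.add[OF module_hom_linearI[OF lin]] module_hom.scale[OF module_hom_linearI[OF lin]] one mult assms comm)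
  qed
qed

text \<open>
  By irreducibility every vector is \<open>x \<xi>\<close> for some \<open>x\<close>, and \<open>e x \<xi> = e x e \<xi>\<close> is a multiple of \<open>\<xi>\<close>. The
  coordinate follows by pairing with \<open>\<xi>\<close>, since \<open>e\<close> is self-adjoint. If \<open>\<xi>\<close> were isotropic, it would be
  orthogonal to \<open>e V\<close>, hence to all of \<open>V\<close>.
\<close>

lemma act_idempotent:
  assumes e: "rank_one e" "e * e = e" "dagger e = e"
    and xi: "\<xi> \<in> range (act e)" "\<xi> \<noteq> 0"
  shows "act e \<xi> = \<xi>"
    and "B (act e v) \<xi> = B v \<xi>"
    and "B \<xi> \<xi> \<noteq> 0"
    and "act e v = scaleV (B v \<xi> / B \<xi> \<xi>) \<xi>"
proof -
  show stay: "act e \<xi> = \<xi>"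
    using xi(1) e(2) by (auto simp flip: V.act_mult)
  show adj: "B (act e v) \<xi> = B v \<xi>" for v
    by (simp add: adjoint e(3) stay)
  have line: "\<exists>c. act e v = scaleV c \<xi>" for v
  proof -
    obtain x where v: "v = act x \<xi>" using cyclic[OF xi(2)] by blast
    have "act e v = act (e * x * e) \<xi>" by (simp add: v V.act_mult stay)
    also have "\<dots> = scaleV (tr (x * e)) \<xi>"
      by (simp add: rank_one_compress[OF e(1)] V.act_scale stay)
    finally show ?thesis by blast
  qed
  show nz: "B \<xi> \<xi> \<noteq> 0"
  proof
    assume 0: "B \<xi> \<xi> = 0"
    have "B u \<xi> = 0" for u
      using adj[of u] line[of u] 0 by (auto simp: B_scale)
    then show False using radical_zero xi(2) by blast
  qed
  obtain c where c: "act e v = scaleV c \<xi>" using line by blast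
  then have "B v \<xi> = c * B \<xi> \<xi>" using adj[of v] by (simp add: B_scale)
  then show "act e v = scaleV (B v \<xi> / B \<xi> \<xi>) \<xi>" using c nz by simp
qed

text \<open>
  The common shape of the identities of the theorem: \<open>c\<close> is the scalar in front of the sum, and \<open>b\<close>
  its inverse, the coefficient with which \<open>Z\<^sub>i v\<close> is a multiple of the target \<open>w\<close>.
\<close>

lemma collapse:
  fixes n :: nat
  assumes "i \<le> n" "\<And>r. r \<le> n \<Longrightarrow> act (Z r) v = (if r = i then scaleV b w else 0)" "b * c = 1"
  shows "act (scaleA c (\<Sum>r\<le>n. X r * Z r)) v = act (X i) w"
proof -
  have "act (\<Sum>r\<le>n. X r * Z r) v = (\<Sum>r\<le>n. if r = i then scaleV b (act (X i) w) else 0)"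
    unfolding act_sum by (rule sum.cong) (auto simp: V.act_mult assms(2))
  also have "\<dots> = scaleV b (act (X i) w)"
    using assms(1) by (subst sum.delta) auto
  finally show ?thesis using assms(3) by (simp add: V.act_scale mult.commute)
qed

end

section \<open>Expansions of the split vectors\<close>

locale leonard_module =
  leonard scaleA d h A E \<theta> As Es \<theta>s + module_form scaleA d h scaleV act dagger B
  for scaleA :: "'k::field \<Rightarrow> 'a::ring_1 \<Rightarrow> 'a" and d h A E \<theta> As Es \<theta>s
    and scaleV :: "'k \<Rightarrow> 'v::ab_group_add \<Rightarrow> 'v" and act dagger B +
  fixes \<xi>0 \<xi>d \<xi>s0 \<xi>sd :: 'v
  assumes dagger_E: "\<And>i. i \<le> d \<Longrightarrow> dagger (E i) = E i"
    and dagger_Es: "\<And>i. i \<le> d \<Longrightarrow> dagger (Es i) = Es i"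
    and xi0: "\<xi>0 \<in> range (act (E 0))" "\<xi>0 \<noteq> 0"
    and xid: "\<xi>d \<in> range (act (E d))" "\<xi>d \<noteq> 0"
    and xis0: "\<xi>s0 \<in> range (act (Es 0))" "\<xi>s0 \<noteq> 0"
    and xisd: "\<xi>sd \<in> range (act (Es d))" "\<xi>sd \<noteq> 0"
begin

text \<open>
  For each of the vectors: it is fixed by its idempotent, the idempotent is self-adjoint
  against it, it is not isotropic, and the coordinate of the projection onto its line is a quotient
  of inner products.
\<close>

lemmas xi0_rules = act_idempotent[OF P.e_rank_one[of 0] _ dagger_E[of 0] xi0, simplified P.e_e, simplified]
lemmas xid_rules = act_idempotent[OF P.e_rank_one[of d] _ dagger_E[of d] xid, simplified P.e_e, simplified]
lemmas xis0_rules = act_idempotent[OF S.e_rank_one[of 0] _ dagger_Es[of 0] xis0, simplified S.e_e, simplified]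
lemmas xisd_rules = act_idempotent[OF S.e_rank_one[of d] _ dagger_Es[of d] xisd, simplified S.e_e, simplified]

text \<open>
  If \<open>e u = 0\<close>, then \<open>f e f\<close> annihilates \<open>u = f u\<close>; but by cancellation \<open>f e f\<close> is a nonzero multiple of \<open>f\<close>.
\<close>

lemma pairing_nonzero:
  assumes e: "rank_one e" "e * f \<noteq> 0" "f * e \<noteq> 0"
    and f: "rank_one f" "f * f = f"
    and u: "act f u = u" "u \<noteq> 0"
    and eu: "act e u = scaleV (b / c) w"
  shows "b \<noteq> 0"
proof
  assume "b = 0"
  then have "act e u = 0" using eu by simp
  have "f * e * f \<noteq> 0" by (rule rank_one_cancel) (use assms in auto)
  then have tr: "tr (e * f) \<noteq> 0" using rank_one_compress[OF f(1), of e] by auto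
  have "scaleV (tr (e * f)) u = act (f * e * f) u"
    by (simp add: rank_one_compress[OF f(1)] V.act_scale u)
  also have "\<dots> = 0" using \<open>act e u = 0\<close> by (simp add: V.act_mult u)
  finally show False using tr u by simp
qed

lemma B_d_s0: "B \<xi>d \<xi>s0 \<noteq> 0"
  by (rule pairing_nonzero[OF _ _ _ _ _ _ _ xis0_rules(4)[of \<xi>d], where f = "E d"])
    (simp_all add: S.e_rank_one P.e_rank_one P.e_e Es_Ed_nonzero E_Es0_nonzero xid xid_rules(1))

lemma B_0_s0: "B \<xi>0 \<xi>s0 \<noteq> 0"
  by (rule pairing_nonzero[OF _ _ _ _ _ _ _ xis0_rules(4)[of \<xi>0], where f = "E 0"])
    (simp_all add: S.e_rank_one P.e_rank_one P.e_e Es_E0_nonzero E_Es0_nonzero xi0 xi0_rules(1))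

lemma B_d_sd: "B \<xi>d \<xi>sd \<noteq> 0"
  by (rule pairing_nonzero[OF _ _ _ _ _ _ _ xisd_rules(4)[of \<xi>d], where f = "E d"])
    (simp_all add: S.e_rank_one P.e_rank_one P.e_e Es_Ed_nonzero E_Esd_nonzero xid xid_rules(1))

lemma tr_Ed_Es0: "tr (E d * Es 0) \<noteq> 0"
  using S.cancel[of 0 "E d" "E d"] E_Es0_nonzero[of d] Es_Ed_nonzero[of 0] P.compress[of d "Es 0"]
  by (auto simp: tr_commute[of "E d"])

lemma expand_Es0:
  assumes "r \<le> d" "i \<le> d"
  shows "act (scaleA (1 / split_prod r) (Es 0 * ev (eta d \<theta> r) A)) (act (ev (tau \<theta>s i) As) \<xi>d)
    = (if r = i then scaleV (B \<xi>d \<xi>s0 / B \<xi>s0 \<xi>s0) \<xi>s0 else 0)"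
proof -
  have "act (scaleA (1 / split_prod r) (Es 0 * ev (eta d \<theta> r) A)) (act (ev (tau \<theta>s i) As) \<xi>d)
      = scaleV (1 / split_prod r) (act (Es 0 * ev (eta d \<theta> r) A * ev (tau \<theta>s i) As * E d) \<xi>d)"
    by (simp add: V.act_scale V.act_mult xid_rules(1))
  also have "\<dots> = (if r = i then act (Es 0) \<xi>d else 0)"
    using split_prod_nonzero[OF assms(1)]
    by (auto simp: Es0_eta_tau_Ed[OF assms] V.act_scale V.act_mult xid_rules(1))
  finally show ?thesis by (simp add: xis0_rules(4))
qed

lemma expand_Ed_Es0:
  assumes "r \<le> d" "i \<le> d"
  shows "act (scaleA (1 / split_prod r) (E d * Es 0 * ev (eta d \<theta> r) A)) (act (ev (tau \<theta>s i) As) \<xi>d)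
    = (if r = i then scaleV (tr (E d * Es 0)) \<xi>d else 0)"
proof -
  have "act (scaleA (1 / split_prod r) (E d * Es 0 * ev (eta d \<theta> r) A)) (act (ev (tau \<theta>s i) As) \<xi>d)
     = act (E d) (act (scaleA (1 / split_prod r) (Es 0 * ev (eta d \<theta> r) A)) (act (ev (tau \<theta>s i) As) \<xi>d))"
    by (simp add: V.act_scale V.act_mult)
  also have "\<dots> = (if r = i then act (E d * Es 0 * E d) \<xi>d else 0)"
    by (simp add: expand_Es0[OF assms] V.act_mult xid_rules(1) xis0_rules(4))
  also have "act (E d * Es 0 * E d) \<xi>d = scaleV (tr (E d * Es 0)) \<xi>d"
    by (simp add: P.compress tr_commute[of "Es 0"] V.act_scale xid_rules(1))
  finally show ?thesis .
qed

text \<open>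
  The vector \<open>E\<^sub>0 (A\<^sup>*)\<^sup>d \<xi>\<^sub>d\<close> is a multiple of \<open>\<xi>\<^sub>0\<close>; pairing with \<open>\<xi>\<^sup>*\<^sub>0\<close> puts \<open>E\<^sup>*\<^sub>0\<close> in front of it, where its
  value is known, and so determines the multiple.
\<close>

lemma expand_E0:
  assumes "r \<le> d" "i \<le> d"
  shows "act (E 0 * ev (eta d \<theta>s (d - r)) As) (act (ev (tau \<theta>s i) As) \<xi>d)
    = (if r = i then scaleV (split_prod d / poly (eta d \<theta> d) (\<theta> 0) * (B \<xi>d \<xi>s0 / B \<xi>0 \<xi>s0)) \<xi>0 else 0)"
proof -
  let ?M = "E 0 * As ^ d * E d" and ?eta = "poly (eta d \<theta> d) (\<theta> 0)"
  have eta: "?eta \<noteq> 0" by (rule poly_eta_nonzero[OF P.inj_t]) simp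
  have "act (E 0 * ev (eta d \<theta>s (d - r)) As) (act (ev (tau \<theta>s i) As) \<xi>d)
      = act (E 0 * ev (eta d \<theta>s (d - r)) As * ev (tau \<theta>s i) As * E d) \<xi>d"
    by (simp add: V.act_mult xid_rules(1))
  also have "\<dots> = (if r = i then act ?M \<xi>d else 0)"
    by (simp add: E0_eta_tau_Ed[OF assms])
  finally have *: "act (E 0 * ev (eta d \<theta>s (d - r)) As) (act (ev (tau \<theta>s i) As) \<xi>d)
    = (if r = i then act ?M \<xi>d else 0)" .
  obtain c where c: "act ?M \<xi>d = scaleV c \<xi>0"
    using xi0_rules(4)[of "act (As ^ d * E d) \<xi>d"] by (auto simp: V.act_mult)
  have "?eta * (c * B \<xi>0 \<xi>s0) = ?eta * B (act (Es 0) (act ?M \<xi>d)) \<xi>s0"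
    by (simp only: c B_scale xis0_rules(2))
  also have "\<dots> = B (act (scaleA ?eta (Es 0 * ?M)) \<xi>d) \<xi>s0"
    by (simp only: V.act_scale B_scale V.act_mult[of "Es 0"])
  also have "\<dots> = split_prod d * B \<xi>d \<xi>s0"
    unfolding Es0_E0_power_Ed
    by (simp add: V.act_scale B_scale V.act_mult xid_rules(1) xis0_rules(2))
  finally have "c = split_prod d / ?eta * (B \<xi>d \<xi>s0 / B \<xi>0 \<xi>s0)"
    using eta B_0_s0 by (simp add: field_simps)
  then show ?thesis using * c by simp
qed

lemma expand_Esd_E0:
  assumes "\<And>k. 1 \<le> k \<Longrightarrow> k \<le> d \<Longrightarrow> f k = (\<theta>s 0 - \<theta>s k) *
        (tr (ev (tau \<theta> k) A * Es 0) / tr (ev (tau \<theta> (k - 1)) A * Es 0))"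
    and "r \<le> d" "i \<le> d"
  shows "act (Es d * E 0 * ev (eta d \<theta>s (d - r)) As) (act (ev (tau \<theta>s i) As) \<xi>d)
    = (if r = i then scaleV ((\<Prod>k=1..d. f k) / poly (eta d \<theta> d) (\<theta> 0) * (B \<xi>d \<xi>sd / B \<xi>sd \<xi>sd)) \<xi>sd else 0)"
proof -
  let ?M = "E 0 * As ^ d * E d" and ?eta = "poly (eta d \<theta> d) (\<theta> 0)"
  have eta: "?eta \<noteq> 0" by (rule poly_eta_nonzero[OF P.inj_t]) simp
  have fsplit: "scaleA ?eta (Es d * ?M) = scaleA (\<Prod>k=1..d. f k) (Es d * E d)"
    by (rule Esd_E0_power_Ed) (rule assms(1))
  have "act (Es d * E 0 * ev (eta d \<theta>s (d - r)) As) (act (ev (tau \<theta>s i) As) \<xi>d)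
      = act (Es d) (act (E 0 * ev (eta d \<theta>s (d - r)) As * ev (tau \<theta>s i) As * E d) \<xi>d)"
    by (simp add: V.act_mult xid_rules(1))
  also have "\<dots> = (if r = i then act (Es d * ?M) \<xi>d else 0)"
    by (simp add: E0_eta_tau_Ed[OF assms(2,3)] V.act_mult)
  also have "Es d * ?M = scaleA (inverse ?eta) (scaleA ?eta (Es d * ?M))"
    using eta by simp
  also have "\<dots> = scaleA ((\<Prod>k=1..d. f k) / ?eta) (Es d * E d)"
    unfolding fsplit by (simp add: divide_inverse mult.commute)
  finally show ?thesis
    by (simp add: V.act_scale V.act_mult xid_rules(1) xisd_rules(4))
qed

end

section \<open>The transition identities\<close>

theorem theorem20p1:
  fixes scaleA :: "'k::field \<Rightarrow> 'a::ring_1 \<Rightarrow> 'a"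
    and scaleV :: "'k \<Rightarrow> 'v::ab_group_add \<Rightarrow> 'v"
    and d :: nat and h :: "'a \<Rightarrow> 'k mat" and act :: "'a \<Rightarrow> 'v \<Rightarrow> 'v"
    and A As :: 'a and E Es :: "nat \<Rightarrow> 'a"
    and \<theta> \<theta>s vphi phi :: "nat \<Rightarrow> 'k"
    and dagger :: "'a \<Rightarrow> 'a" and B :: "'v \<Rightarrow> 'v \<Rightarrow> 'k"
    and \<xi>0 \<xi>d \<xi>s0 \<xi>sd :: 'v
  assumes "full_matrix_algebra scaleA d h"
    and "irreducible_left_module scaleV scaleA act"
    and "leonard_system scaleA d h A E As Es"
    and "parameter_array scaleA d h A E As Es \<theta> \<theta>s vphi phi"
    and "antiautomorphism scaleA dagger" and "dagger A = A" and "dagger As = As"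
    and "bilinear_form scaleV B" and "\<exists>u v. B u v \<noteq> 0"
    and "\<And>x u v. B (act x u) v = B u (act (dagger x) v)"
    and "\<xi>0 \<in> range (act (E 0))" and "\<xi>0 \<noteq> 0"
    and "\<xi>d \<in> range (act (E d))" and "\<xi>d \<noteq> 0"
    and "\<xi>s0 \<in> range (act (Es 0))" and "\<xi>s0 \<noteq> 0"
    and "\<xi>sd \<in> range (act (Es d))" and "\<xi>sd \<noteq> 0"
  shows
    "(\<forall>X \<in> {E,
            \<lambda>i. E (d - i),
            \<lambda>i. poly_alg scaleA (tau \<theta> i) A,
            \<lambda>i. poly_alg scaleA (tau \<theta> (d - i)) A,
            \<lambda>i. poly_alg scaleA (eta d \<theta> i) A,
            \<lambda>i. poly_alg scaleA (eta d \<theta> (d - i)) A}.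
        \<forall>i\<le>d.
          act (scaleA (B \<xi>s0 \<xi>s0 / B \<xi>d \<xi>s0)
               (\<Sum>r\<le>d. scaleA (1 / (\<Prod>k=1..r. phi k)) (X r * Es 0 * poly_alg scaleA (eta d \<theta> r) A)))
            (act (poly_alg scaleA (tau \<theta>s i) As) \<xi>d) = act (X i) \<xi>s0 \<and>
          act (scaleA (poly (eta d \<theta> d) (\<theta> 0) / (\<Prod>k=1..d. vphi k) * (B \<xi>sd \<xi>sd / B \<xi>d \<xi>sd))
               (\<Sum>r\<le>d. X r * Es d * E 0 * poly_alg scaleA (eta d \<theta>s (d - r)) As))
            (act (poly_alg scaleA (tau \<theta>s i) As) \<xi>d) = act (X i) \<xi>sd \<and>
          act (scaleA (B \<xi>s0 \<xi>s0 / B \<xi>d \<xi>s0)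
               (\<Sum>r\<le>d. scaleA (1 / (\<Prod>k=1..r. phi k)) (X (d - r) * Es 0 * poly_alg scaleA (eta d \<theta> r) A)))
            (act (poly_alg scaleA (tau \<theta>s (d - i)) As) \<xi>d) = act (X i) \<xi>s0 \<and>
          act (scaleA (poly (eta d \<theta> d) (\<theta> 0) / (\<Prod>k=1..d. vphi k) * (B \<xi>sd \<xi>sd / B \<xi>d \<xi>sd))
               (\<Sum>r\<le>d. X (d - r) * Es d * E 0 * poly_alg scaleA (eta d \<theta>s (d - r)) As))
            (act (poly_alg scaleA (tau \<theta>s (d - i)) As) \<xi>d) = act (X i) \<xi>sd) \<and>
     (\<forall>X \<in> {Es,
            \<lambda>i. Es (d - i),
            \<lambda>i. poly_alg scaleA (tau \<theta>s i) As,
            \<lambda>i. poly_alg scaleA (tau \<theta>s (d - i)) As,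
            \<lambda>i. poly_alg scaleA (eta d \<theta>s i) As,
            \<lambda>i. poly_alg scaleA (eta d \<theta>s (d - i)) As}.
        \<forall>i\<le>d.
          act (scaleA (poly (eta d \<theta> d) (\<theta> 0) / (\<Prod>k=1..d. phi k) * (B \<xi>0 \<xi>s0 / B \<xi>d \<xi>s0))
               (\<Sum>r\<le>d. X r * E 0 * poly_alg scaleA (eta d \<theta>s (d - r)) As))
            (act (poly_alg scaleA (tau \<theta>s i) As) \<xi>d) = act (X i) \<xi>0 \<and>
          act (scaleA (1 / mat_trace (h (E d * Es 0)))
               (\<Sum>r\<le>d. scaleA (1 / (\<Prod>k=1..r. phi k)) (X r * E d * Es 0 * poly_alg scaleA (eta d \<theta> r) A)))
            (act (poly_alg scaleA (tau \<theta>s i) As) \<xi>d) = act (X i) \<xi>d \<and>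
          act (scaleA (poly (eta d \<theta> d) (\<theta> 0) / (\<Prod>k=1..d. phi k) * (B \<xi>0 \<xi>s0 / B \<xi>d \<xi>s0))
               (\<Sum>r\<le>d. X (d - r) * E 0 * poly_alg scaleA (eta d \<theta>s (d - r)) As))
            (act (poly_alg scaleA (tau \<theta>s (d - i)) As) \<xi>d) = act (X i) \<xi>0 \<and>
          act (scaleA (1 / mat_trace (h (E d * Es 0)))
               (\<Sum>r\<le>d. scaleA (1 / (\<Prod>k=1..r. phi k)) (X (d - r) * E d * Es 0 * poly_alg scaleA (eta d \<theta> r) A)))
            (act (poly_alg scaleA (tau \<theta>s (d - i)) As) \<xi>d) = act (X i) \<xi>d)"
proof -
  interpret R: full_matrix_algebra scaleA d h by fact
  interpret V: irreducible_left_module scaleV scaleA act by fact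
  note leo = assms(3)[unfolded leonard_system_def]
    and par = assms(4)[unfolded parameter_array_def]
  interpret P: simple_spectrum scaleA d h A E \<theta>
    using leo par by (intro R.simple_spectrum_primitive_idempotents) auto
  interpret S: simple_spectrum scaleA d h As Es \<theta>s
    using leo par by (intro R.simple_spectrum_primitive_idempotents) auto
  interpret M: module_form scaleA d h scaleV act dagger B
    by unfold_locales (use assms(5-10) in auto)
  interpret L: leonard_module scaleA d h A E \<theta> As Es \<theta>s scaleV act dagger B \<xi>0 \<xi>d \<xi>s0 \<xi>sd
  proof unfold_locales
    show "dagger (E i) = E i" if "i \<le> d" for i
      using that par by (simp add: primitive_idempotent_def M.dagger_ev[OF assms(6)])
    show "dagger (Es i) = Es i" if "i \<le> d" for i
      using that par by (simp add: primitive_idempotent_def M.dagger_ev[OF assms(7)])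
  qed (use leo assms in auto)
  have phi: "(\<Prod>k=1..r. phi k) = L.split_prod r" if "r \<le> d" for r
    by (rule L.prod_split[OF that]) (use par in auto)
  have vphi: "vphi k = (\<theta>s 0 - \<theta>s k) * (mat_trace (h (poly_alg scaleA (tau \<theta> k) A * Es 0)) /
      mat_trace (h (poly_alg scaleA (tau \<theta> (k - 1)) A * Es 0)))" if "1 \<le> k" "k \<le> d" for k
    using par that by auto
  have vphi0: "(\<Prod>k=1..d. vphi k) \<noteq> 0"
    by (rule L.prod_first_split(2)) (rule vphi)
  have eta0: "poly (eta d \<theta> d) (\<theta> 0) \<noteq> 0"
    by (rule poly_eta_nonzero[OF P.inj_t]) simp
  let ?v = "\<lambda>i. act (poly_alg scaleA (tau \<theta>s i) As) \<xi>d"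
  have Z0: "act (scaleA (1 / (\<Prod>k=1..r. phi k)) (Es 0 * poly_alg scaleA (eta d \<theta> r) A)) (?v i)
    = (if r = i then scaleV (B \<xi>d \<xi>s0 / B \<xi>s0 \<xi>s0) \<xi>s0 else 0)" if "r \<le> d" "i \<le> d" for r i
    unfolding phi[OF that(1)] by (rule L.expand_Es0[OF that])
  have Zd: "act (scaleA (1 / (\<Prod>k=1..r. phi k)) (E d * Es 0 * poly_alg scaleA (eta d \<theta> r) A)) (?v i)
    = (if r = i then scaleV (mat_trace (h (E d * Es 0))) \<xi>d else 0)" if "r \<le> d" "i \<le> d" for r i
    unfolding phi[OF that(1)] by (rule L.expand_Ed_Es0[OF that])
  have onto_s0: "act (scaleA (B \<xi>s0 \<xi>s0 / B \<xi>d \<xi>s0)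
      (\<Sum>r\<le>d. scaleA (1 / (\<Prod>k=1..r. phi k)) (X r * Es 0 * poly_alg scaleA (eta d \<theta> r) A))) (?v i)
    = act (X i) \<xi>s0" if "i \<le> d" for X i
    using M.collapse[OF that Z0[OF _ that], where X = X and c = "B \<xi>s0 \<xi>s0 / B \<xi>d \<xi>s0"]
      L.xis0_rules(3) L.B_d_s0
    by (simp add: mult.assoc)
  have onto_d: "act (scaleA (1 / mat_trace (h (E d * Es 0)))
      (\<Sum>r\<le>d. scaleA (1 / (\<Prod>k=1..r. phi k)) (X r * E d * Es 0 * poly_alg scaleA (eta d \<theta> r) A))) (?v i)
    = act (X i) \<xi>d" if "i \<le> d" for X i
    using M.collapse[OF that Zd[OF _ that], where X = X and c = "1 / mat_trace (h (E d * Es 0))"]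
      L.tr_Ed_Es0
    by (simp add: mult.assoc)
  have onto_0: "act (scaleA (poly (eta d \<theta> d) (\<theta> 0) / (\<Prod>k=1..d. phi k) * (B \<xi>0 \<xi>s0 / B \<xi>d \<xi>s0))
      (\<Sum>r\<le>d. X r * E 0 * poly_alg scaleA (eta d \<theta>s (d - r)) As)) (?v i)
    = act (X i) \<xi>0" if "i \<le> d" for X i
    using M.collapse[OF that L.expand_E0[OF _ that], where X = X
        and c = "poly (eta d \<theta> d) (\<theta> 0) / (\<Prod>k=1..d. phi k) * (B \<xi>0 \<xi>s0 / B \<xi>d \<xi>s0)"]
      L.B_0_s0 L.B_d_s0 eta0 L.split_prod_nonzero[of d]
    by (simp add: phi[unfolded One_nat_def] mult.assoc)
  have onto_sd: "act (scaleA (poly (eta d \<theta> d) (\<theta> 0) / (\<Prod>k=1..d. vphi k) * (B \<xi>sd \<xi>sd / B \<xi>d \<xi>sd))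
      (\<Sum>r\<le>d. X r * Es d * E 0 * poly_alg scaleA (eta d \<theta>s (d - r)) As)) (?v i)
    = act (X i) \<xi>sd" if "i \<le> d" for X i
    using M.collapse[OF that L.expand_Esd_E0[OF vphi _ that], where X = X
        and c = "poly (eta d \<theta> d) (\<theta> 0) / (\<Prod>k=1..d. vphi k) * (B \<xi>sd \<xi>sd / B \<xi>d \<xi>sd)"]
      L.xisd_rules(3) L.B_d_sd eta0 vphi0
    by (simp add: mult.assoc)
  \<comment> \<open>The reflected identities are instances for the sequence \<open>X\<^bsub>d-r\<^esub>\<close>, as \<open>d - (d - i) = i\<close>.\<close>
  show ?thesis
    using onto_s0 onto_d onto_0 onto_sd
      onto_s0[of "d - i" "\<lambda>r. X (d - r)" for i X] onto_d[of "d - i" "\<lambda>r. X (d - r)" for i X]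
      onto_0[of "d - i" "\<lambda>r. X (d - r)" for i X] onto_sd[of "d - i" "\<lambda>r. X (d - r)" for i X]
    by (intro conjI ballI allI impI) simp_all
qed

end
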